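(* Let $J>1$, $\beta>0$ with $\beta J>1$, and let $c\ge 0$ be a fixed constant. Let $(X_n)$ be a sequence of (possibly random, defined on a common probability space) real symmetric $n\times n$ matrices with eigenvalues $\lambda_1\ge\lambda_2\ge\dots\ge\lambda_n$ (depending on $n$) such that $\lambda_1=J+\frac1J$, $\lambda_2=\lambda_1-\frac{c}{n}$, the empirical measure of $\lambda_2\ge\dots\ge\lambda_n$ converges weakly almost surely to the semicircular law $\mu_{\mathrm{sc}}$, and the rigidity condition given in the context holds almost surely. Let $F_n(\beta)=\log Z_n(\beta)$ be the free energy. Then, almost surely, as $n\to\infty$, $$\frac{F_n(\beta)}{n}\to \frac{\beta}{2}\left(J+\frac1J\right)\left(1-\frac{1}{\beta J}\right)+\frac12\log\left(\frac{1}{\beta J}\right)+\frac{1}{4J^2}.$$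
   Context: $\mathbb{S}_{n-1}=\{\underline{\sigma}\in\mathbb{R}^n:\|\underline{\sigma}\|^2=1\}$ is the unit sphere and $\mu_n$ is the uniform probability measure on it. The Hamiltonian is $H_n(\underline{\sigma})=\frac n2\,\underline{\sigma}'X_n\underline{\sigma}$ for $\underline\sigma\in\mathbb{S}_{n-1}$. The partition function at inverse temperature $\beta>0$ is $Z_n(\beta)=\int_{\mathbb{S}_{n-1}}\exp\{\beta H_n(\underline\sigma)\}\,d\mu_n(\underline\sigma)$ and the free energy is $F_n(\beta)=\log Z_n(\beta)$. "Almost surely" refers to the randomness of the sequence $(X_n)$. The semicircular law $\mu_{\mathrm{sc}}$ is the probability measure on $[-2,2]$ with density $\frac{1}{2\pi}\sqrt{4-x^2}$. Rigidity condition: for an integer $K\ge1$ let $2=\tilde\lambda_1\ge\tilde\lambda_2\ge\dots\ge\tilde\lambda_{K+1}=-2$ be such that $\int_{\tilde\lambda_{j+1}}^{\tilde\lambda_j}d\mu_{\mathrm{sc}}=\frac1K$ for $1\le j\le K$. The condition is: for every $\varepsilon>0$ there is $K_0$ such that for every $K\ge K_0$ and all sufficiently large $n$ (depending on $K$ and on the realization), $$\sup_{1\le i\le K}\ \sup_{\frac{(i-1)(n-2)}{K}+3\le j\le\frac{i(n-2)}{K}+2}|\lambda_j-\tilde\lambda_i|\le\varepsilon,$$ where $j$ ranges over integers. *)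

theory Defs
  imports
    "HOL-Probability.Probability"
    "Jordan_Normal_Form.Char_Poly"
begin

(* Eigenvalues are numbered from 1 in decreasing order and counted with multiplicity.
   A real symmetric n x n matrix has n real eigenvalues, so "eigval A j" is meaningful for
   1 <= j <= n. *)
definition eigval :: "real mat \<Rightarrow> nat \<Rightarrow> real" where
  "eigval A j = rev (sorted_list_of_multiset (proots (char_poly A))) ! (j - 1)"

definition real_symmetric :: "nat \<Rightarrow> real mat \<Rightarrow> bool" where
  "real_symmetric n A \<longleftrightarrow> A \<in> carrier_mat n n \<and> transpose_mat A = A"

(* As the dimension n varies within one statement, R^n is the set of functions on {..<n}
   (extended by "undefined"), carrying the product of n copies of Lebesgue measure. *)
definition unit_ball :: "nat \<Rightarrow> (nat \<Rightarrow> real) set" where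
  "unit_ball n = {x \<in> {..<n} \<rightarrow>\<^sub>E UNIV. (\<Sum>i<n. (x i)\<^sup>2) \<le> 1}"

definition unit_sphere :: "nat \<Rightarrow> (nat \<Rightarrow> real) set" where
  "unit_sphere n = {x \<in> {..<n} \<rightarrow>\<^sub>E UNIV. (\<Sum>i<n. (x i)\<^sup>2) = 1}"

(* Normalized surface measure: the mass of a set A of directions is the relative volume of
   the cone {t * x | 0 < t <= 1, x in A} in the unit ball, i.e. the law of x / |x| for x uniform
   in the ball. The ambient space of the measure is all of R^n; for n >= 1 it is concentrated
   on the sphere, since the centre of the ball has volume 0. *)
definition sphere_measure :: "nat \<Rightarrow> (nat \<Rightarrow> real) measure" where
  "sphere_measure n =
     distr (uniform_measure (\<Pi>\<^sub>M i\<in>{..<n}. lborel) (unit_ball n)) (\<Pi>\<^sub>M i\<in>{..<n}. borel)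
       (\<lambda>x. \<lambda>i\<in>{..<n}. x i / L2_set x {..<n})"

definition hamiltonian :: "nat \<Rightarrow> real mat \<Rightarrow> (nat \<Rightarrow> real) \<Rightarrow> real" where
  "hamiltonian n A \<sigma> =
     real n / 2 * scalar_prod (Matrix.vec n \<sigma>) (mult_mat_vec A (Matrix.vec n \<sigma>))"

definition partition_function :: "nat \<Rightarrow> real mat \<Rightarrow> real \<Rightarrow> real" where
  "partition_function n A \<beta> =
     (LINT \<sigma>:unit_sphere n|sphere_measure n. exp (\<beta> * hamiltonian n A \<sigma>))"

definition free_energy :: "nat \<Rightarrow> real mat \<Rightarrow> real \<Rightarrow> real" where
  "free_energy n A \<beta> = ln (partition_function n A \<beta>)"

definition semicircle :: "real measure" where
  "semicircle =
     density lborel (\<lambda>x. ennreal (indicator {-2..2} x * (sqrt (4 - x\<^sup>2) / (2 * pi))))"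

definition empirical_measure_from_2 :: "nat \<Rightarrow> real mat \<Rightarrow> real measure" where
  "empirical_measure_from_2 n A = distr (uniform_count_measure {2..n}) borel (eigval A)"

definition semicircle_quantiles :: "nat \<Rightarrow> (nat \<Rightarrow> real) \<Rightarrow> bool" where
  "semicircle_quantiles K q \<longleftrightarrow>
     q 1 = 2 \<and> q (K + 1) = -2 \<and>
     (\<forall>j\<in>{1..K}. q (j + 1) \<le> q j \<and> measure semicircle {q (j + 1)..q j} = 1 / real K)"

(* "q K" lists the quantiles for K, and "lam n j" is the j-th largest eigenvalue of the n-th
   matrix. The bound on a supremum of absolute values is written as a bound on each of them. *)
definition rigid :: "(nat \<Rightarrow> nat \<Rightarrow> real) \<Rightarrow> (nat \<Rightarrow> nat \<Rightarrow> real) \<Rightarrow> bool" where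
  "rigid q lam \<longleftrightarrow>
     (\<forall>\<epsilon>>0. \<exists>K0\<ge>1. \<forall>K\<ge>K0. \<forall>\<^sub>F n in sequentially.
        \<forall>i\<in>{1..K}. \<forall>j::nat.
          (real i - 1) * (real n - 2) / real K + 3 \<le> real j \<and>
          real j \<le> real i * (real n - 2) / real K + 2 \<longrightarrow>
          \<bar>lam n j - q K i\<bar> \<le> \<epsilon>)"

end

theory Submission
  imports Defs "HOL-Real_Asymp.Real_Asymp"
begin

text \<open>
  Write \<open>\<lambda>\<close> for the top eigenvalue \<open>J + 1 / J\<close> of the symmetric matrix \<open>A\<close>. As the uniform measure on
  the sphere is the law of the direction of a uniform point of the unit ball, the partition function
  times the volume of the ball is the integral over the ball of
  \<open>exp (n \<beta> / 2 * (x\<^sup>T A x) / |x|\<^sup>2)\<close>. This integral is compared with the Gaussian integrals of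
  \<open>exp (- c x\<^sup>T (\<gamma> I - A) x)\<close> for \<open>\<gamma> > \<lambda>\<close>, which are explicit in terms of \<open>det (\<gamma> I - A)\<close>
  (\<open>pos_def_gaussian\<close>).

  For the upper bound (\<open>cone_integral_upper\<close>), the integrand on the ball is at most
  \<open>exp (n \<beta> / 2 * \<gamma>)\<close> times the Gaussian weight with \<open>c = n \<beta> / 2\<close>.

  For the lower bound (\<open>cone_integral_lower\<close>), the low-temperature phase requires a macroscopic
  component along a unit top eigenvector \<open>v\<close>: the integral is restricted to a thin shell below the
  unit sphere and compared with the Gaussian weight centred at \<open>s v\<close>. Under this weight the squared
  norm concentrates at \<open>s\<^sup>2 + 1 / (\<beta> J)\<close> up to small corrections, so \<open>s\<^sup>2\<close> is taken close to
  \<open>1 - 1 / (\<beta> J)\<close>, which is positive because \<open>\<beta> J > 1\<close>. The mass outside the shell is negligible by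
  Chernoff bounds (\<open>shifted_gauss_tail\<close>, \<open>tail_negligible\<close>), in which the tilted integrals are again
  Gaussian integrals of the same family.

  Both bounds have the same exponential rate as \<open>\<gamma>\<close> decreases to \<open>\<lambda>\<close> and the shell shrinks. It
  involves the limit of \<open>ln (det (\<gamma> I - A)) / n\<close>, the logarithmic potential of the semicircle law at \<open>\<gamma>\<close>
  (\<open>log_det_limit\<close>), which equals \<open>ln p + 1 / (2 p\<^sup>2)\<close> at \<open>\<gamma> = p + 1 / p\<close> (\<open>semicircle_log_integral\<close>),
  and the asymptotics of the volume of the ball (\<open>ln_unit_ball_vol_asymp\<close>). The rigidity
  condition keeps the spectrum bounded below, so that the logarithm may be replaced there by a bounded
  continuous function.
\<close>

section \<open>Gaussian integrals of positive definite forms\<close>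

text \<open>
  The bilinear form \<open>x\<^sup>T B y\<close> on \<open>\<real>\<^sup>n\<close>. Vectors are functions on \<open>nat\<close>, of which only the values
  below \<open>n\<close> matter; this is the format of the points of the product measure on \<open>{..<n}\<close>.
\<close>
definition bil :: "nat \<Rightarrow> real mat \<Rightarrow> (nat \<Rightarrow> real) \<Rightarrow> (nat \<Rightarrow> real) \<Rightarrow> real" where
  "bil n B x y = (\<Sum>i<n. \<Sum>j<n. B $$ (i, j) * x i * y j)"

text \<open>Positive definiteness of the quadratic form of \<open>B\<close>; symmetry is a separate hypothesis.\<close>
definition pos_def :: "nat \<Rightarrow> real mat \<Rightarrow> bool" where
  "pos_def n B \<longleftrightarrow> (\<forall>x. (\<exists>i<n. x i \<noteq> 0) \<longrightarrow> bil n B x x > 0)"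

lemma real_symmetric_entry:
  "real_symmetric n A \<Longrightarrow> i < n \<Longrightarrow> j < n \<Longrightarrow> A $$ (i, j) = A $$ (j, i)"
  unfolding real_symmetric_def by (metis carrier_matD index_transpose_mat(1))

lemma bil_commute:
  assumes "real_symmetric n B"
  shows "bil n B x y = bil n B y x"
proof -
  have s: "B $$ (i, j) = B $$ (j, i)" if "i < n" "j < n" for i j
    using real_symmetric_entry[OF assms] that by blast
  have "bil n B x y = (\<Sum>j<n. \<Sum>i<n. B $$ (i, j) * x i * y j)"
    unfolding bil_def by (rule sum.swap)
  also have "\<dots> = bil n B y x"
    unfolding bil_def by (intro sum.cong refl) (use s in \<open>simp add: mult_ac\<close>)
  finally show ?thesis .
qed

lemma bil_diff_left: "bil n B (\<lambda>i. x i - y i) z = bil n B x z - bil n B y z"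
  and bil_diff_right: "bil n B z (\<lambda>i. x i - y i) = bil n B z x - bil n B z y"
  and bil_scale_left: "bil n B (\<lambda>i. t * x i) z = t * bil n B x z"
  and bil_scale_right: "bil n B z (\<lambda>i. t * x i) = t * bil n B z x"
  by (simp_all add: bil_def algebra_simps sum.distrib sum_subtractf sum_distrib_left)

text \<open>The Schur complement of the last diagonal entry of an \<open>(n + 1) \<times> (n + 1)\<close> matrix.\<close>
definition schur_complement :: "nat \<Rightarrow> real mat \<Rightarrow> real mat" where
  "schur_complement n B =
     mat n n (\<lambda>(i, j). B $$ (i, j) - B $$ (i, n) * B $$ (n, j) / B $$ (n, n))"

text \<open>Completing the square in the last coordinate.\<close>
lemma schur_complement_bil:
  fixes B :: "real mat"
  assumes B: "real_symmetric (Suc n) B" and b: "B $$ (n, n) \<noteq> 0"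
  defines "S \<equiv> schur_complement n B"
  shows "bil (Suc n) B x x =
     B $$ (n, n) * (x n + (\<Sum>i<n. B $$ (n, i) * x i) / B $$ (n, n))\<^sup>2 + bil n S x x"
proof -
  let ?b = "B $$ (n, n)" and ?l = "\<Sum>i<n. B $$ (n, i) * x i"
  have s: "B $$ (i, n) = B $$ (n, i)" if "i < n" for i
    using real_symmetric_entry[OF B] that by simp
  have "bil n S x x = (\<Sum>i<n. \<Sum>j<n. B $$ (i, j) * x i * x j) -
      (\<Sum>i<n. \<Sum>j<n. (B $$ (n, i) * x i) * (B $$ (n, j) * x j)) / ?b"
    unfolding bil_def S_def schur_complement_def sum_divide_distrib sum_subtractf [symmetric]
    by (intro sum.cong refl) (simp add: s field_simps)
  also have "(\<Sum>i<n. \<Sum>j<n. (B $$ (n, i) * x i) * (B $$ (n, j) * x j)) = ?l\<^sup>2"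
    by (simp add: power2_eq_square sum_product)
  finally have 1: "bil n S x x = (\<Sum>i<n. \<Sum>j<n. B $$ (i, j) * x i * x j) - ?l\<^sup>2 / ?b" .
  have "bil (Suc n) B x x = (\<Sum>i<n. \<Sum>j<n. B $$ (i, j) * x i * x j)
      + (\<Sum>i<n. B $$ (i, n) * x i * x n) + (\<Sum>i<n. B $$ (n, i) * x n * x i) + ?b * x n * x n"
    unfolding bil_def by (simp add: sum.distrib algebra_simps)
  also have "(\<Sum>i<n. B $$ (i, n) * x i * x n) = x n * ?l"
    unfolding sum_distrib_left by (intro sum.cong refl) (simp add: s mult_ac)
  also have "(\<Sum>i<n. B $$ (n, i) * x n * x i) = x n * ?l"
    unfolding sum_distrib_left by (intro sum.cong refl) (simp add: mult_ac)
  finally show ?thesis unfolding 1 using b by (simp add: field_simps power2_eq_square)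
qed

lemma schur_complement_det:
  fixes B :: "real mat"
  assumes B: "B \<in> carrier_mat (Suc n) (Suc n)" and b: "B $$ (n, n) \<noteq> 0"
  defines "S \<equiv> schur_complement n B"
  shows "det B = B $$ (n, n) * det S"
proof -
  let ?b = "B $$ (n, n)"
  define D where "D = mat 1 1 (\<lambda>_. ?b)"
  define w where "w = mat n 1 (\<lambda>(i, _). B $$ (i, n))"
  define z where "z = mat 1 n (\<lambda>(_, j). - B $$ (n, j) / ?b)"
  define C where "C = mat n n (\<lambda>(i, j). B $$ (i, j))"
  define N where "N = four_block_mat (1\<^sub>m n) (0\<^sub>m n 1) z (1\<^sub>m 1)"
  have c: "D \<in> carrier_mat 1 1" "w \<in> carrier_mat n 1" "z \<in> carrier_mat 1 n" "C \<in> carrier_mat n n"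
    "S \<in> carrier_mat n n" by (auto simp: D_def w_def z_def C_def S_def schur_complement_def)
  have Bb: "B = four_block_mat C w (mat 1 n (\<lambda>(_, j). B $$ (n, j))) D"
    using B by (intro eq_matI) (auto simp: C_def w_def D_def less_Suc_eq)
  \<comment> \<open>Column operations clear the last row of \<open>B\<close> left of the diagonal.\<close>
  have "B * N = four_block_mat (C * 1\<^sub>m n + w * z) (C * 0\<^sub>m n 1 + w * 1\<^sub>m 1)
      (mat 1 n (\<lambda>(_, j). B $$ (n, j)) * 1\<^sub>m n + D * z)
      (mat 1 n (\<lambda>(_, j). B $$ (n, j)) * 0\<^sub>m n 1 + D * 1\<^sub>m 1)"
    unfolding N_def by (subst Bb, rule mult_four_block_mat) (use c in auto)
  also have "C * 1\<^sub>m n + w * z = S"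
    using c by (intro eq_matI) (auto simp: C_def w_def z_def S_def schur_complement_def scalar_prod_def)
  also have "C * 0\<^sub>m n 1 + w * 1\<^sub>m 1 = w" using c by simp
  also have "mat 1 n (\<lambda>(_, j). B $$ (n, j)) * 1\<^sub>m n + D * z = 0\<^sub>m 1 n"
    using c b by (intro eq_matI) (auto simp: D_def z_def scalar_prod_def)
  also have "mat 1 n (\<lambda>(_, j). B $$ (n, j)) * 0\<^sub>m n 1 + D * 1\<^sub>m 1 = D" using c by simp
  finally have BN: "B * N = four_block_mat S w (0\<^sub>m 1 n) D" .
  have N: "N \<in> carrier_mat (Suc n) (Suc n)" unfolding N_def using c by auto
  have detN: "det N = 1"
    unfolding N_def by (subst det_four_block_mat_upper_right_zero[of _ n _ 1]) (use c in auto)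
  have "det B = det (B * N)" using det_mult[OF B N] detN by simp
  also have "\<dots> = det S * det D"
    unfolding BN by (rule det_four_block_mat_lower_left_zero) (use c in auto)
  also have "det D = ?b" by (subst det_single) (auto simp: D_def)
  finally show ?thesis by simp
qed

lemma gaussian_nn_integral_1:
  fixes b a :: real
  assumes "b > 0"
  shows "(\<integral>\<^sup>+x. ennreal (exp (- b * (x - a)\<^sup>2)) \<partial>lborel) = ennreal (sqrt (pi / b))"
proof -
  define \<sigma> where "\<sigma> = sqrt (1 / (2 * b))"
  have \<sigma>: "\<sigma> > 0" "\<sigma>\<^sup>2 = 1 / (2 * b)" using assms by (simp_all add: \<sigma>_def)
  interpret prob_space "density lborel (normal_density a \<sigma>)"
    by (rule prob_space_normal_density[OF \<sigma>(1)])
  have 1: "exp (- b * (x - a)\<^sup>2) = sqrt (pi / b) * normal_density a \<sigma> x" for x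
    using assms by (simp add: normal_density_def \<sigma>(2) field_simps)
  have "(\<integral>\<^sup>+x. ennreal (exp (- b * (x - a)\<^sup>2)) \<partial>lborel)
      = (\<integral>\<^sup>+x. ennreal (sqrt (pi / b)) * ennreal (normal_density a \<sigma> x) \<partial>lborel)"
    unfolding 1 using assms by (simp add: ennreal_mult'')
  also have "\<dots> = ennreal (sqrt (pi / b)) * (\<integral>\<^sup>+x. ennreal (normal_density a \<sigma> x) \<partial>lborel)"
    by (rule nn_integral_cmult) simp
  also have "(\<integral>\<^sup>+x. ennreal (normal_density a \<sigma> x) \<partial>lborel) = 1"
    using emeasure_space_1 by (simp add: emeasure_density)
  finally show ?thesis by simp
qed

text \<open>
  The Gaussian integral with an arbitrary centre \<open>u\<close>. The induction integrates out the last
  coordinate and passes to the Schur complement, so that only Fubini's theorem and the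
  one-dimensional integral are used: neither a diagonalisation nor the invariance of the product
  measure under rotations or translations is needed, since the centre is carried along.
\<close>
lemma pos_def_gaussian:
  assumes "real_symmetric n B" and "pos_def n B"
  shows "det B > 0 \<and> (\<integral>\<^sup>+x. ennreal (exp (- bil n B (\<lambda>i. x i - u i) (\<lambda>i. x i - u i)))
      \<partial>(\<Pi>\<^sub>M i\<in>{..<n}. lborel)) = ennreal (sqrt (pi ^ n / det B))"
  using assms
proof (induction n arbitrary: B)
  case 0
  then have "det B = 1" by (auto simp: real_symmetric_def)
  then show ?case by (simp add: bil_def PiM_empty)
next
  case (Suc n)
  interpret product_sigma_finite "\<lambda>_::nat. lborel :: real measure" by standard
  let ?b = "B $$ (n, n)"
  define S where "S = schur_complement n B"
  define l where "l x = (\<Sum>i<n. B $$ (n, i) * x i) / ?b" for x :: "nat \<Rightarrow> real"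
  have B: "B \<in> carrier_mat (Suc n) (Suc n)"
    and Bs: "\<And>i j. i < Suc n \<Longrightarrow> j < Suc n \<Longrightarrow> B $$ (i, j) = B $$ (j, i)"
    using Suc.prems(1) by (simp add: real_symmetric_def) (rule real_symmetric_entry[OF Suc.prems(1)])
  have "bil (Suc n) B (\<lambda>i. if i = n then 1 else 0) (\<lambda>i. if i = n then 1 else 0) = ?b"
    by (simp add: bil_def)
  moreover have "bil (Suc n) B (\<lambda>i. if i = n then 1 else 0) (\<lambda>i. if i = n then 1 else 0) > 0"
    using Suc.prems(2) unfolding pos_def_def by force
  ultimately have b: "?b > 0" by simp
  have split: "bil (Suc n) B x x = ?b * (x n + l x)\<^sup>2 + bil n S x x" for x
    unfolding S_def l_def using b by (intro schur_complement_bil Suc.prems) auto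
  have bil_cong: "bil n S x y = bil n S x' y'" if "\<And>i. i < n \<Longrightarrow> x i = x' i" "\<And>i. i < n \<Longrightarrow> y i = y' i"
    for x x' y y' unfolding bil_def using that by simp
  have l_cong: "l x = l x'" if "\<And>i. i < n \<Longrightarrow> x i = x' i" for x x'
    unfolding l_def using that by simp
  have symS: "real_symmetric n S"
    unfolding real_symmetric_def S_def schur_complement_def using B Bs by (auto intro!: eq_matI)
  have pdS: "pos_def n S"
    unfolding pos_def_def
  proof (intro allI impI)
    fix x :: "nat \<Rightarrow> real" assume x: "\<exists>i<n. x i \<noteq> 0"
    \<comment> \<open>The last coordinate that annihilates the completed square.\<close>
    define x' where "x' = x(n := - l x)"
    have "l x' = l x" "bil n S x' x' = bil n S x x"
      by (auto intro!: l_cong bil_cong simp: x'_def)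
    then have "bil (Suc n) B x' x' = bil n S x x" unfolding split by (simp add: x'_def)
    moreover have "\<exists>i<Suc n. x' i \<noteq> 0" using x by (auto simp: x'_def intro: less_SucI)
    ultimately show "bil n S x x > 0" using Suc.prems(2) unfolding pos_def_def by metis
  qed
  have IH: "det S > 0" and IHi: "(\<integral>\<^sup>+x. ennreal (exp (- bil n S (\<lambda>i. x i - u i) (\<lambda>i. x i - u i)))
      \<partial>(\<Pi>\<^sub>M i\<in>{..<n}. lborel)) = ennreal (sqrt (pi ^ n / det S))"
    using Suc.IH[OF symS pdS] by auto
  have detB: "det B = ?b * det S" unfolding S_def using B b by (intro schur_complement_det) auto
  let ?f = "\<lambda>x. ennreal (exp (- bil (Suc n) B (\<lambda>i. x i - u i) (\<lambda>i. x i - u i)))"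
  have "(\<integral>\<^sup>+x. ?f x \<partial>(\<Pi>\<^sub>M i\<in>{..<Suc n}. lborel)) =
      (\<integral>\<^sup>+x. ?f x \<partial>(\<Pi>\<^sub>M i\<in>insert n {..<n}. lborel))" by (simp add: lessThan_Suc)
  also have "\<dots> = (\<integral>\<^sup>+x. (\<integral>\<^sup>+y. ?f (x(n := y)) \<partial>lborel) \<partial>(\<Pi>\<^sub>M i\<in>{..<n}. lborel))"
    by (rule product_nn_integral_insert) (auto simp: bil_def simp del: sum.lessThan_Suc simp flip: lessThan_Suc)
  also have "\<dots> = (\<integral>\<^sup>+x. ennreal (sqrt (pi / ?b)) *
      ennreal (exp (- bil n S (\<lambda>i. x i - u i) (\<lambda>i. x i - u i))) \<partial>(\<Pi>\<^sub>M i\<in>{..<n}. lborel))"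
  proof (rule nn_integral_cong)
    fix x :: "nat \<Rightarrow> real"
    let ?x = "\<lambda>i. x i - u i"
    have 1: "?f (x(n := y)) = ennreal (exp (- bil n S ?x ?x)) * ennreal (exp (- ?b * (y - (u n - l ?x))\<^sup>2))" for y
    proof -
      let ?y = "\<lambda>i. (x(n := y)) i - u i"
      have "l ?y = l ?x" "bil n S ?y ?y = bil n S ?x ?x" by (auto intro!: l_cong bil_cong)
      then have "bil (Suc n) B ?y ?y = ?b * (y - u n + l ?x)\<^sup>2 + bil n S ?x ?x"
        unfolding split by simp
      then show ?thesis by (simp add: ennreal_mult[symmetric] exp_add[symmetric] algebra_simps)
    qed
    show "(\<integral>\<^sup>+y. ?f (x(n := y)) \<partial>lborel) = ennreal (sqrt (pi / ?b)) * ennreal (exp (- bil n S ?x ?x))"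
      unfolding 1 by (subst nn_integral_cmult) (simp_all add: gaussian_nn_integral_1[OF b, simplified] mult.commute)
  qed
  also have "\<dots> = ennreal (sqrt (pi / ?b)) * ennreal (sqrt (pi ^ n / det S))"
    by (subst nn_integral_cmult) (auto simp: IHi[unfolded bil_def] bil_def)
  also have "\<dots> = ennreal (sqrt (pi ^ Suc n / det B))"
    using b IH by (simp add: ennreal_mult[symmetric] real_sqrt_mult[symmetric] detB)
  finally show ?case using b IH detB by simp
qed

section \<open>Spectra of real symmetric matrices\<close>

text \<open>The matrix \<open>\<gamma> I - A\<close>.\<close>
definition shifted :: "nat \<Rightarrow> real \<Rightarrow> real mat \<Rightarrow> real mat" where
  "shifted n \<gamma> A = \<gamma> \<cdot>\<^sub>m 1\<^sub>m n - A"

text \<open>The squared Euclidean norm on \<open>\<real>\<^sup>n\<close>.\<close>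
definition sqnorm :: "nat \<Rightarrow> (nat \<Rightarrow> real) \<Rightarrow> real" where
  "sqnorm n x = (\<Sum>i<n. (x i)\<^sup>2)"

lemma sqnorm_nonneg [simp]: "sqnorm n x \<ge> 0"
  by (simp add: sqnorm_def sum_nonneg)

lemma sqnorm_pos_iff: "sqnorm n x > 0 \<longleftrightarrow> (\<exists>i<n. x i \<noteq> 0)"
proof -
  have "sqnorm n x = 0 \<longleftrightarrow> (\<forall>i<n. x i = 0)"
    unfolding sqnorm_def by (subst sum_nonneg_eq_0_iff) auto
  then show ?thesis using sqnorm_nonneg[of n x] by (auto simp: less_le)
qed

lemma square_le_sqnorm: "i < n \<Longrightarrow> (x i)\<^sup>2 \<le> sqnorm n x"
  unfolding sqnorm_def by (rule member_le_sum) auto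

lemma bil_shifted:
  assumes "A \<in> carrier_mat n n"
  shows "bil n (shifted n \<gamma> A) x y = \<gamma> * (\<Sum>i<n. x i * y i) - bil n A x y"
proof -
  have "bil n (shifted n \<gamma> A) x y = (\<Sum>i<n. \<Sum>j<n. (if j = i then \<gamma> * x i * y i else 0) - A $$ (i, j) * x i * y j)"
    unfolding bil_def by (intro sum.cong refl) (use assms in \<open>auto simp: shifted_def algebra_simps\<close>)
  also have "\<dots> = (\<Sum>i<n. \<gamma> * x i * y i) - bil n A x y"
    by (simp add: sum_subtractf bil_def)
  finally show ?thesis by (simp add: sum_distrib_left mult_ac)
qed

lemma bil_shifted_self:
  assumes "A \<in> carrier_mat n n"
  shows "bil n (shifted n \<gamma> A) x x = \<gamma> * sqnorm n x - bil n A x x"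
  by (simp add: bil_shifted[OF assms] sqnorm_def power2_eq_square)

lemma real_symmetric_shifted: "real_symmetric n A \<Longrightarrow> real_symmetric n (shifted n \<gamma> A)"
proof -
  assume A: "real_symmetric n A"
  then have s: "A $$ (i, j) = A $$ (j, i)" if "i < n" "j < n" for i j
    using real_symmetric_entry that by blast
  then show ?thesis using A unfolding real_symmetric_def shifted_def
    by (auto intro!: eq_matI)
qed

lemma det_shifted:
  assumes "A \<in> carrier_mat n n"
  shows "det (shifted n \<gamma> A) = poly (char_poly A) \<gamma>"
proof -
  have "shifted n \<gamma> A = - char_matrix A \<gamma>"
    using assms unfolding shifted_def char_matrix_def by (intro eq_matI) auto
  then show ?thesis using char_poly_matrix[OF assms] by simp
qed

lemma bil_bounded: "\<bar>bil n B x x\<bar> \<le> (\<Sum>i<n. \<Sum>j<n. \<bar>B $$ (i, j)\<bar>) * sqnorm n x"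
proof -
  have 1: "\<bar>x i\<bar> * \<bar>x j\<bar> \<le> sqnorm n x" if "i < n" "j < n" for i j
  proof -
    have "\<bar>x i\<bar> * \<bar>x j\<bar> \<le> sqrt (sqnorm n x) * sqrt (sqnorm n x)"
      by (intro mult_mono real_le_rsqrt) (use that square_le_sqnorm[of _ n x] in auto)
    then show ?thesis by simp
  qed
  have "\<bar>bil n B x x\<bar> \<le> (\<Sum>i<n. \<Sum>j<n. \<bar>B $$ (i, j) * x i * x j\<bar>)"
    unfolding bil_def by (intro order.trans[OF sum_abs] sum_mono order.trans[OF sum_abs] order.refl)
  also have "\<dots> \<le> (\<Sum>i<n. \<Sum>j<n. \<bar>B $$ (i, j)\<bar> * sqnorm n x)"
    by (intro sum_mono) (auto simp: abs_mult mult.assoc intro!: mult_left_mono 1)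
  finally show ?thesis by (simp add: sum_distrib_right)
qed

lemma bil_Cauchy_Schwarz:
  assumes B: "real_symmetric n B" and psd: "\<And>x. bil n B x x \<ge> 0"
  shows "(bil n B x y)\<^sup>2 \<le> bil n B x x * bil n B y y"
proof -
  let ?a = "bil n B y y" and ?b = "bil n B x y" and ?c = "bil n B x x"
  have q: "?c - 2 * t * ?b + t\<^sup>2 * ?a \<ge> 0" for t
  proof -
    have "bil n B (\<lambda>i. x i - t * y i) (\<lambda>i. x i - t * y i) = ?c - 2 * t * ?b + t\<^sup>2 * ?a"
      by (simp add: bil_diff_left bil_diff_right bil_scale_left bil_scale_right
          bil_commute[OF B, of y x] algebra_simps power2_eq_square)
    then show ?thesis using psd by metis
  qed
  show ?thesis
  proof (cases "?a = 0")
    case True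
    have "?b = 0"
    proof (rule ccontr)
      assume b: "?b \<noteq> 0"
      then have "2 * ((?c + 1) / (2 * ?b)) * ?b = ?c + 1" by simp
      then show False using q[of "(?c + 1) / (2 * ?b)"] True by simp
    qed
    then show ?thesis using True by simp
  next
    case False
    then have a: "?a > 0" using psd[of y] by simp
    have "?c - 2 * (?b / ?a) * ?b + (?b / ?a)\<^sup>2 * ?a = ?c - ?b\<^sup>2 / ?a"
      using a by (simp add: field_simps power2_eq_square)
    then have "?b\<^sup>2 / ?a \<le> ?c" using q[of "?b / ?a"] by simp
    then show ?thesis using a by (simp add: field_simps)
  qed
qed

text \<open>
  A nonsingular positive semidefinite form is bounded below by a multiple of the squared norm:
  apply the Cauchy-Schwarz inequality for the form to \<open>x\<close> and the solution \<open>z\<close> of \<open>B z = x\<close>.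
\<close>
lemma bil_coercive:
  assumes B: "real_symmetric n B" and psd: "\<And>x. bil n B x x \<ge> 0" and det: "det B \<noteq> 0"
  obtains \<epsilon> where "\<epsilon> > 0" and "\<And>x. bil n B x x \<ge> \<epsilon> * sqnorm n x"
proof -
  have Bc: "B \<in> carrier_mat n n" using B by (simp add: real_symmetric_def)
  obtain N where N: "N \<in> carrier_mat n n" "B * N = 1\<^sub>m n"
    using det_non_zero_imp_unit[OF Bc det] unfolding Units_def by (auto simp: ring_mat_def)
  have BN: "(\<Sum>j<n. B $$ (i, j) * N $$ (j, k)) = (if i = k then 1 else 0)" if "i < n" "k < n" for i k
  proof -
    have "(B * N) $$ (i, k) = (\<Sum>j<n. B $$ (i, j) * N $$ (j, k))"
      using that Bc N(1) by (simp add: scalar_prod_def lessThan_atLeast0)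
    then show ?thesis unfolding N(2) using that by simp
  qed
  define C where "C = 1 + (\<Sum>i<n. \<Sum>j<n. \<bar>N $$ (i, j)\<bar>)"
  have C: "C > 0" unfolding C_def by (simp add: add_pos_nonneg sum_nonneg)
  have "bil n B x x \<ge> inverse C * sqnorm n x" for x
  proof (cases "sqnorm n x = 0")
    case False
    then have pos: "sqnorm n x > 0" using sqnorm_nonneg[of n x] by linarith
    define z where "z i = (\<Sum>j<n. N $$ (i, j) * x j)" for i
    have Bz: "(\<Sum>j<n. B $$ (i, j) * z j) = x i" if "i < n" for i
    proof -
      have "(\<Sum>j<n. B $$ (i, j) * z j) = (\<Sum>j<n. \<Sum>k<n. B $$ (i, j) * N $$ (j, k) * x k)"
        unfolding z_def by (simp add: sum_distrib_left mult_ac)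
      also have "\<dots> = (\<Sum>k<n. (\<Sum>j<n. B $$ (i, j) * N $$ (j, k)) * x k)"
        by (subst sum.swap) (simp add: sum_distrib_right)
      also have "\<dots> = (\<Sum>k<n. if k = i then x k else 0)"
        by (intro sum.cong refl) (use that in \<open>simp add: BN\<close>)
      finally show ?thesis using that by simp
    qed
    have bz: "bil n B y z = (\<Sum>i<n. y i * x i)" for y
    proof -
      have "bil n B y z = (\<Sum>i<n. y i * (\<Sum>j<n. B $$ (i, j) * z j))"
        unfolding bil_def by (simp add: sum_distrib_left mult_ac)
      also have "\<dots> = (\<Sum>i<n. y i * x i)" by (intro sum.cong refl) (simp add: Bz)
      finally show ?thesis .
    qed
    have "bil n B z z = bil n N x x"
      unfolding bz unfolding z_def bil_def by (simp add: sum_distrib_left sum_distrib_right mult_ac)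
    also have "\<dots> \<le> C * sqnorm n x"
      using abs_le_D1[OF bil_bounded[of n N x]] sqnorm_nonneg[of n x] unfolding C_def distrib_right by linarith
    finally have zz: "bil n B z z \<le> C * sqnorm n x" .
    have "(sqnorm n x)\<^sup>2 = (bil n B x z)\<^sup>2" unfolding bz by (simp add: sqnorm_def power2_eq_square)
    also have "\<dots> \<le> bil n B x x * bil n B z z" by (rule bil_Cauchy_Schwarz[OF B psd])
    also have "\<dots> \<le> bil n B x x * (C * sqnorm n x)" by (intro mult_left_mono zz psd)
    finally have "sqnorm n x \<le> bil n B x x * C" using pos by (simp add: power2_eq_square)
    then show ?thesis using C by (simp add: field_simps)
  qed (use psd in simp)
  then show ?thesis using that[of "inverse C"] C by simp
qed

text \<open>
  The Rayleigh bound. If the least \<open>g\<close> for which \<open>g I - A\<close> is positive semidefinite exceeded \<open>l\<close>,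
  it would not be a root of the characteristic polynomial, so that \<open>g I - A\<close> would be coercive and
  \<open>g\<close> could be lowered.
\<close>
lemma bil_le_of_no_larger_root:
  assumes A: "real_symmetric n A" and root: "\<And>\<gamma>. \<gamma> > l \<Longrightarrow> poly (char_poly A) \<gamma> \<noteq> 0"
  shows "bil n A x x \<le> l * sqnorm n x"
proof -
  have Ac: "A \<in> carrier_mat n n" using A by (simp add: real_symmetric_def)
  define G where "G = {\<gamma>. \<forall>x. bil n A x x \<le> \<gamma> * sqnorm n x}"
  have up: "\<gamma>' \<in> G" if "\<gamma> \<in> G" "\<gamma> \<le> \<gamma>'" for \<gamma> \<gamma>'
    using that sqnorm_nonneg unfolding G_def
    by (smt (verit) mem_Collect_eq mult_right_mono)
  have ne: "G \<noteq> {}"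
    using bil_bounded[of n A] unfolding G_def by (auto simp: abs_le_iff)
  have "l \<in> G"
  proof (rule ccontr)
    assume l: "l \<notin> G"
    then have lb: "\<gamma> \<ge> l" if "\<gamma> \<in> G" for \<gamma> using up[OF that, of l] by force
    then have bdd: "bdd_below G" by (auto simp: bdd_below_def)
    define g where "g = Inf G"
    have gG: "g \<in> G"
      unfolding G_def
    proof safe
      fix x
      show "bil n A x x \<le> g * sqnorm n x"
      proof (rule field_le_epsilon)
        fix e :: real assume e: "e > 0"
        define d where "d = e / (1 + sqnorm n x)"
        have s: "1 + sqnorm n x > 0" by (simp add: add_pos_nonneg)
        have d: "d > 0" unfolding d_def using e s by simp
        then obtain \<gamma> where \<gamma>: "\<gamma> \<in> G" "\<gamma> < g + d"
          using cInf_lessD[OF ne, of "g + d"] unfolding g_def by auto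
        have "bil n A x x \<le> \<gamma> * sqnorm n x" using \<gamma>(1) unfolding G_def by simp
        also have "\<dots> \<le> (g + d) * sqnorm n x" using \<gamma> by (intro mult_right_mono) auto
        also have "\<dots> \<le> g * sqnorm n x + d * (1 + sqnorm n x)" using d by (simp add: algebra_simps)
        also have "d * (1 + sqnorm n x) = e" unfolding d_def using s by simp
        finally show "bil n A x x \<le> g * sqnorm n x + e" .
      qed
    qed
    have gl: "g > l" using lb[OF gG] l gG by (metis less_le)
    have "bil n (shifted n g A) x x \<ge> 0" for x
      using gG by (simp add: bil_shifted_self[OF Ac] G_def)
    then obtain \<epsilon> where \<epsilon>: "\<epsilon> > 0" "\<And>x. bil n (shifted n g A) x x \<ge> \<epsilon> * sqnorm n x"
      using bil_coercive[OF real_symmetric_shifted[OF A]] root[OF gl] det_shifted[OF Ac] by metis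
    then have "g - \<epsilon> \<in> G" by (simp add: bil_shifted_self[OF Ac] G_def algebra_simps)
    then show False using \<epsilon>(1) cInf_lower[OF _ bdd] unfolding g_def by force
  qed
  then show ?thesis by (simp add: G_def)
qed

text \<open>
  Over \<open>\<complex>\<close> the characteristic polynomial splits, and every complex eigenvalue is real because the
  Hermitian form of \<open>A\<close> takes real values.
\<close>
lemma real_symmetric_char_poly_splits:
  assumes A: "real_symmetric n A"
  obtains rs where "char_poly A = (\<Prod>r\<leftarrow>rs. [:- r, 1:])" and "length rs = n"
proof -
  have Ac: "A \<in> carrier_mat n n" using A by (simp add: real_symmetric_def)
  have sym: "A $$ (i, j) = A $$ (j, i)" if "i < n" "j < n" for i j
    using real_symmetric_entry[OF A] that by blast
  define AC where "AC = map_mat complex_of_real A"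
  have ACc: "AC \<in> carrier_mat n n" unfolding AC_def using Ac by simp
  have hom: "char_poly AC = map_poly complex_of_real (char_poly A)"
    unfolding AC_def by (rule of_real_hom.char_poly_hom[OF Ac])
  obtain as where as: "char_poly AC = (\<Prod>a\<leftarrow>as. [:- a, 1:])" "length as = n"
    using char_poly_factorized[OF ACc] by blast
  have real: "a = complex_of_real (Re a)" if "a \<in> set as" for a
  proof -
    have "poly (char_poly AC) a = 0"
      unfolding as(1) poly_prod_list prod_list_zero_iff using that by force
    then have "eigenvalue AC a" by (simp add: eigenvalue_root_char_poly[OF ACc])
    then obtain v where v: "v \<in> carrier_vec n" "v \<noteq> 0\<^sub>v n" "AC *\<^sub>v v = a \<cdot>\<^sub>v v"
      using ACc unfolding eigenvalue_def eigenvector_def by auto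
    have Av: "(\<Sum>j<n. complex_of_real (A $$ (i, j)) * v $ j) = a * v $ i" if "i < n" for i
    proof -
      have "(AC *\<^sub>v v) $ i = (\<Sum>j<n. complex_of_real (A $$ (i, j)) * v $ j)"
        using that Ac v(1) by (simp add: AC_def scalar_prod_def lessThan_atLeast0)
      then show ?thesis unfolding v(3) using that v(1) by simp
    qed
    define N where "N = (\<Sum>i<n. (cmod (v $ i))\<^sup>2)"
    define H where "H = (\<Sum>i<n. \<Sum>j<n. complex_of_real (A $$ (i, j)) * cnj (v $ i) * v $ j)"
    have "H = (\<Sum>i<n. cnj (v $ i) * (\<Sum>j<n. complex_of_real (A $$ (i, j)) * v $ j))"
      unfolding H_def by (simp add: sum_distrib_left mult_ac)
    also have "\<dots> = (\<Sum>i<n. a * (v $ i * cnj (v $ i)))"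
      by (intro sum.cong refl, subst Av) (auto simp: mult_ac)
    also have "\<dots> = a * of_real N"
      unfolding N_def by (simp add: complex_norm_square sum_distrib_left del: of_real_power)
    finally have H1: "H = a * of_real N" .
    have "cnj H = (\<Sum>i<n. \<Sum>j<n. complex_of_real (A $$ (i, j)) * v $ i * cnj (v $ j))"
      unfolding H_def by simp
    also have "\<dots> = (\<Sum>j<n. \<Sum>i<n. complex_of_real (A $$ (i, j)) * v $ i * cnj (v $ j))"
      by (rule sum.swap)
    also have "\<dots> = H"
      unfolding H_def by (intro sum.cong refl) (use sym in \<open>simp add: mult_ac\<close>)
    finally have H2: "cnj H = H" .
    have "\<exists>i<n. v $ i \<noteq> 0" using v(1,2) by (metis eq_vecI carrier_vecD index_zero_vec)
    then obtain i where i: "i < n" "v $ i \<noteq> 0" by blast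
    have "(cmod (v $ i))\<^sup>2 \<le> N" unfolding N_def by (rule member_le_sum) (use i in auto)
    moreover have "(cmod (v $ i))\<^sup>2 > 0" using i by simp
    ultimately have "N > 0" by linarith
    then have "cnj a = a" using H1 H2 by simp
    then show ?thesis by (metis Reals_cnj_iff complex_is_Real_iff of_real_Re)
  qed
  define rs where "rs = map Re as"
  interpret map_poly_inj_idom_hom complex_of_real ..
  have "map_poly complex_of_real (\<Prod>r\<leftarrow>rs. [:- r, 1:]) = (\<Prod>a\<leftarrow>as. [:- complex_of_real (Re a), 1:])"
    unfolding rs_def hom_prod_list by (simp add: o_def)
  also have "map (\<lambda>a. [:- complex_of_real (Re a), 1:]) as = map (\<lambda>a. [:- a, 1:]) as"
    by (intro map_cong refl) (metis real)
  also have "prod_list \<dots> = map_poly complex_of_real (char_poly A)" using as(1) hom by simp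
  finally have "char_poly A = (\<Prod>r\<leftarrow>rs. [:- r, 1:])" by simp
  then show ?thesis using as(2) by (intro that[of rs]) (simp_all add: rs_def)
qed

text \<open>The numbered eigenvalues exhaust the roots with multiplicity, in decreasing order.\<close>
lemma eigval_properties:
  assumes A: "real_symmetric n A"
  shows poly_char_poly_eigval: "poly (char_poly A) \<gamma> = (\<Prod>j=1..n. \<gamma> - eigval A j)"
    and eigval_antimono: "1 \<le> i \<Longrightarrow> i \<le> j \<Longrightarrow> j \<le> n \<Longrightarrow> eigval A j \<le> eigval A i"
proof -
  obtain rs where rs: "char_poly A = (\<Prod>r\<leftarrow>rs. [:- r, 1:])" "length rs = n"
    using real_symmetric_char_poly_splits[OF A] .
  have "proots (\<Prod>r\<leftarrow>rs. [:- r, 1:]) = mset rs"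
  proof (induction rs)
    case (Cons r rs)
    have "(\<Prod>r\<leftarrow>rs. [:- r, 1:]) \<noteq> 0" by (auto simp: prod_list_zero_iff)
    then have "proots ([:- r, 1:] * (\<Prod>r\<leftarrow>rs. [:- r, 1:])) = {#r#} + proots (\<Prod>r\<leftarrow>rs. [:- r, 1:])"
      by (subst proots_mult) (simp_all del: mult_pCons_left)
    then show ?case using Cons by (simp del: mult_pCons_left)
  qed simp
  then have pr: "proots (char_poly A) = mset rs" by (simp add: rs(1))
  define es where "es = rev (sorted_list_of_multiset (proots (char_poly A)))"
  have es: "mset es = mset rs" by (simp add: es_def pr)
  then have len: "length es = n" using rs(2) mset_eq_length by metis
  have ev: "eigval A j = es ! (j - 1)" for j by (simp add: eigval_def es_def)
  have "poly (char_poly A) \<gamma> = (\<Prod>r\<leftarrow>rs. \<gamma> - r)"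
    unfolding rs(1) poly_prod_list by (simp add: o_def)
  also have "\<dots> = prod_mset (image_mset (\<lambda>r. \<gamma> - r) (mset rs))"
    by (metis mset_map prod_mset_prod_list)
  also have "\<dots> = (\<Prod>r\<leftarrow>es. \<gamma> - r)"
    unfolding es[symmetric] by (metis mset_map prod_mset_prod_list)
  also have "\<dots> = (\<Prod>i<n. \<gamma> - es ! i)"
    by (subst prod.list_conv_set_nth) (simp add: len lessThan_atLeast0)
  also have "\<dots> = (\<Prod>j=1..n. \<gamma> - eigval A j)"
    by (rule prod.reindex_bij_witness[of _ "\<lambda>j. j - 1" Suc]) (auto simp: ev)
  finally show "poly (char_poly A) \<gamma> = (\<Prod>j=1..n. \<gamma> - eigval A j)" .
  show "eigval A j \<le> eigval A i" if "1 \<le> i" "i \<le> j" "j \<le> n"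
  proof -
    have "sorted (rev es)" by (simp add: es_def)
    then show ?thesis unfolding ev using that len
      by (intro sorted_rev_nth_mono) auto
  qed
qed

lemma det_shifted_eigval:
  assumes "real_symmetric n A"
  shows "det (shifted n \<gamma> A) = (\<Prod>j=1..n. \<gamma> - eigval A j)"
  using assms poly_char_poly_eigval[OF assms] det_shifted[of A n]
  by (simp add: real_symmetric_def)

lemma bil_le_eigval_1:
  assumes A: "real_symmetric n A"
  shows "bil n A x x \<le> eigval A 1 * sqnorm n x"
proof (rule bil_le_of_no_larger_root[OF A])
  fix \<gamma> assume g: "\<gamma> > eigval A 1"
  show "poly (char_poly A) \<gamma> \<noteq> 0"
    unfolding poly_char_poly_eigval[OF A] prod_zero_iff[OF finite_atLeastAtMost]
    using eigval_antimono[OF A, of 1] g by force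
qed

lemma pos_def_shifted:
  assumes A: "real_symmetric n A" and \<gamma>: "\<gamma> > eigval A 1"
  shows "pos_def n (shifted n \<gamma> A)"
  unfolding pos_def_def
proof (intro allI impI)
  fix x :: "nat \<Rightarrow> real" assume "\<exists>i<n. x i \<noteq> 0"
  then have "sqnorm n x > 0" by (simp add: sqnorm_pos_iff)
  then have "(\<gamma> - eigval A 1) * sqnorm n x > 0" using \<gamma> by simp
  then show "bil n (shifted n \<gamma> A) x x > 0"
    using bil_le_eigval_1[OF A, of x] A
    by (simp add: bil_shifted_self real_symmetric_def algebra_simps)
qed

lemma unit_top_eigenvector:
  assumes A: "real_symmetric n A" and n: "n \<ge> 1"
  obtains v where "sqnorm n v = 1" and "\<And>x. bil n A x v = eigval A 1 * (\<Sum>i<n. x i * v i)"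
proof -
  let ?l = "eigval A 1"
  have Ac: "A \<in> carrier_mat n n" using A by (simp add: real_symmetric_def)
  have "poly (char_poly A) ?l = 0"
    unfolding poly_char_poly_eigval[OF A] prod_zero_iff[OF finite_atLeastAtMost] using n by force
  then have "eigenvalue A ?l" by (simp add: eigenvalue_root_char_poly[OF Ac])
  then obtain w where w: "w \<in> carrier_vec n" "w \<noteq> 0\<^sub>v n" "A *\<^sub>v w = ?l \<cdot>\<^sub>v w"
    using Ac unfolding eigenvalue_def eigenvector_def by auto
  have Aw: "(\<Sum>j<n. A $$ (i, j) * w $ j) = ?l * w $ i" if "i < n" for i
  proof -
    have "(A *\<^sub>v w) $ i = (\<Sum>j<n. A $$ (i, j) * w $ j)"
      using that Ac w(1) by (simp add: scalar_prod_def lessThan_atLeast0)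
    then show ?thesis unfolding w(3) using that w(1) by simp
  qed
  have "\<exists>i<n. w $ i \<noteq> 0" using w(1,2) by (metis eq_vecI carrier_vecD index_zero_vec)
  then have pos: "sqnorm n (\<lambda>i. w $ i) > 0" by (simp add: sqnorm_pos_iff)
  define r where "r = 1 / sqrt (sqnorm n (\<lambda>i. w $ i))"
  have r: "r\<^sup>2 * sqnorm n (\<lambda>i. w $ i) = 1" unfolding r_def using pos by (simp add: power_divide)
  have "sqnorm n (\<lambda>i. r * w $ i) = 1"
    using r unfolding sqnorm_def by (simp add: power_mult_distrib sum_distrib_left)
  moreover have "bil n A x (\<lambda>i. r * w $ i) = ?l * (\<Sum>i<n. x i * (r * w $ i))" for x
  proof -
    have "bil n A x (\<lambda>i. w $ i) = (\<Sum>i<n. x i * (\<Sum>j<n. A $$ (i, j) * w $ j))"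
      unfolding bil_def by (simp add: sum_distrib_left mult_ac)
    also have "\<dots> = (\<Sum>i<n. x i * (?l * w $ i))"
      by (intro sum.cong refl) (simp add: Aw)
    finally show ?thesis
      unfolding bil_scale_right by (simp add: sum_distrib_left mult_ac)
  qed
  ultimately show ?thesis using that by blast
qed

section \<open>The logarithmic potential of the semicircle law\<close>

lemma integral_cos_nat:
  fixes m :: nat
  shows "(LBINT t. cos (real m * t) * indicator {0..pi} t) = (if m = 0 then pi else 0)"
proof (cases "m = 0")
  case False
  have "(LBINT t. cos (real m * t) * indicator {0..pi} t) = sin (real m * pi) / m - sin (real m * 0) / m"
    by (rule integral_FTC_Icc_real)
       (use False in \<open>auto intro!: derivative_eq_intros continuous_intros\<close>)
  then show ?thesis using False sin_npi[of m] by (simp add: mult.commute)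
qed simp

lemma integral_sin_squared_cos:
  fixes m :: nat
  shows "(LBINT t. (2 / pi * (sin t)\<^sup>2 * cos (real m * t)) * indicator {0..pi} t)
    = (if m = 0 then 1 else if m = 2 then - 1 / 2 else 0)" (is "?I = _")
proof -
  have int: "integrable lborel (\<lambda>t. cos (real k * t) * indicator {0..pi} t)" for k :: nat
    using borel_integrable_atLeastAtMost'[of 0 pi "\<lambda>t. cos (real k * t)"]
    by (simp add: set_integrable_def mult.commute continuous_intros)
  define d where "d = (if m \<ge> 2 then m - 2 else 2 - m)"
  have d: "cos (real d * t) = cos (real m * t - 2 * t)" for t
  proof (cases "m \<ge> 2")
    case False
    then have "real d * t = - (real m * t - 2 * t)" by (simp add: d_def algebra_simps of_nat_diff)
    then show ?thesis by (simp only: cos_minus)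
  qed (simp add: d_def algebra_simps of_nat_diff)
  have eq: "2 / pi * (sin t)\<^sup>2 * cos (real m * t) =
      1 / pi * (cos (real m * t) - cos (real d * t) / 2 - cos (real (m + 2) * t) / 2)" for t
  proof -
    have "2 * (sin t)\<^sup>2 * cos (real m * t) = (1 - cos (2 * t)) * cos (real m * t)"
      by (simp add: cos_double_sin)
    also have "\<dots> = cos (real m * t) - (cos (real m * t + 2 * t) + cos (real m * t - 2 * t)) / 2"
      by (simp add: cos_add cos_diff algebra_simps)
    finally have "2 * (sin t)\<^sup>2 * cos (real m * t) =
      cos (real m * t) - cos (real d * t) / 2 - cos (real (m + 2) * t) / 2"
      unfolding d by (simp add: left_diff_distrib add.commute distrib_right diff_divide_distrib add_divide_distrib)
    then show ?thesis by (simp add: field_simps)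
  qed
  have "?I = (LBINT t. 1 / pi * (cos (real m * t) * indicator {0..pi} t
      - cos (real d * t) * indicator {0..pi} t / 2 - cos (real (m + 2) * t) * indicator {0..pi} t / 2))"
    unfolding eq by (intro Bochner_Integration.integral_cong refl) (simp add: algebra_simps)
  also have "\<dots> = 1 / pi * ((LBINT t. cos (real m * t) * indicator {0..pi} t)
      - (LBINT t. cos (real d * t) * indicator {0..pi} t) / 2
      - (LBINT t. cos (real (m + 2) * t) * indicator {0..pi} t) / 2)"
    using int[of m] int[of d] int[of "m + 2"]
    by (subst integral_mult_right_zero, subst Bochner_Integration.integral_diff, simp, simp,
        subst Bochner_Integration.integral_diff) (simp_all del: of_nat_add)
  also have "\<dots> = (if m = 0 then 1 else if m = 2 then - 1 / 2 else 0)"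
    unfolding integral_cos_nat by (auto simp: d_def)
  finally show ?thesis .
qed

text \<open>The expansion of \<open>ln p + 2 Re (Ln (1 + e\<^sup>i\<^sup>t / p))\<close> in powers of \<open>1 / p\<close>.\<close>
lemma ln_cos_sums:
  fixes p t :: real
  assumes p: "p > 1"
  shows "(\<lambda>m. (if m = 0 then ln p else - 2 * (- 1 / p) ^ m / m) * cos (real m * t)) sums
     ln (p + 1 / p + 2 * cos t)"
proof -
  define z where "z = cis t / of_real p"
  have z: "cmod z < 1" using p by (simp add: z_def norm_divide)
  have Re_z: "Re (z ^ m) = cos (real m * t) / p ^ m" for m
    using p by (simp add: z_def power_divide Complex.DeMoivre Re_divide_of_real flip: of_real_power)
   
  have ne: "1 + z \<noteq> 0" using z by (metis add.commute add_eq_0_iff norm_minus_cancel norm_one less_irrefl)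
  have "(\<lambda>m. (- 1) ^ Suc m / of_nat m * z ^ m) sums Ln (1 + z)" using Ln_series[OF z] by simp
  then have S: "(\<lambda>m. Re ((- 1) ^ Suc m / of_nat m * z ^ m)) sums Re (Ln (1 + z))" by (rule sums_Re)
  have T: "Re ((- 1) ^ Suc m / of_nat m * z ^ m) = - ((- 1 / p) ^ m / m * cos (real m * t))" for m
  proof -
    have "(- 1) ^ Suc m / of_nat m * z ^ m = of_real ((- 1) ^ Suc m / of_nat m) * z ^ m" by simp
    moreover have "Re (of_real r * w) = r * Re w" for r w by simp
    ultimately have "Re ((- 1) ^ Suc m / of_nat m * z ^ m) = ((- 1) ^ Suc m / of_nat m) * Re (z ^ m)"
      by (simp only:)
    moreover have "(- 1 / p) ^ m = (- 1) ^ m / p ^ m" by (rule power_divide)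
    ultimately show ?thesis unfolding Re_z by simp
  qed
  have U: "Re (Ln (1 + z)) = ln (p + 1 / p + 2 * cos t) / 2 - ln p / 2"
  proof -
    have "(cmod (1 + z))\<^sup>2 = (1 + cos t / p)\<^sup>2 + (sin t / p)\<^sup>2"
      using p by (simp add: cmod_power2 z_def cis.sel Re_divide_of_real Im_divide_of_real)
    also have "\<dots> = 1 + 2 * cos t / p + ((sin t)\<^sup>2 + (cos t)\<^sup>2) / p\<^sup>2"
      by (simp add: power2_sum power_divide add_divide_distrib del: sin_cos_squared_add)
    also have "\<dots> = (p + 1 / p + 2 * cos t) / p"
      using p by (simp add: field_simps power2_eq_square)
    finally have 1: "(cmod (1 + z))\<^sup>2 = (p + 1 / p + 2 * cos t) / p" .
    have "(cmod (1 + z))\<^sup>2 > 0" using ne by simp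
    then have 2: "p + 1 / p + 2 * cos t > 0" unfolding 1 using p by (simp add: zero_less_divide_iff)
    have "2 * Re (Ln (1 + z)) = ln ((cmod (1 + z))\<^sup>2)"
      using ne by (simp add: ln_realpow)
    also have "\<dots> = ln (p + 1 / p + 2 * cos t) - ln p"
      unfolding 1 using 2 p by (simp add: ln_div)
    finally show ?thesis by simp
  qed
  from S have "(\<lambda>m. - ((- 1 / p) ^ m / m * cos (real m * t))) sums
      (ln (p + 1 / p + 2 * cos t) / 2 - ln p / 2)" unfolding T U .
  then have "(\<lambda>m. 2 * - ((- 1 / p) ^ m / m * cos (real m * t))) sums
      (2 * (ln (p + 1 / p + 2 * cos t) / 2 - ln p / 2))" by (rule sums_mult)
  then have "(\<lambda>m. 2 * - ((- 1 / p) ^ m / m * cos (real m * t)) + (if m = 0 then ln p else 0)) sums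
      (2 * (ln (p + 1 / p + 2 * cos t) / 2 - ln p / 2) + ln p)"
    by (intro sums_add) (use sums_single[of 0 "\<lambda>_. ln p"] in \<open>simp_all add: sums_If_finite_set\<close>)
  then show ?thesis by (rule sums_cong[THEN iffD1, rotated, elim_format]) auto
qed

text \<open>
  The logarithmic potential of the semicircle law at \<open>p + 1 / p\<close>. After the substitution
  \<open>x = - 2 cos t\<close> the density becomes \<open>(2 / \<pi>) sin\<^sup>2 t = (1 / \<pi>) (1 - cos (2 t))\<close>, so that only the
  terms \<open>m = 0\<close> and \<open>m = 2\<close> of the cosine series of the logarithm contribute.
\<close>
lemma semicircle_log_integral:
  fixes p :: real
  assumes p: "p > 1"
  shows "(LINT x|semicircle. ln (p + 1 / p - x)) = ln p + 1 / (2 * p\<^sup>2)"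
proof -
  define f where "f x = sqrt (4 - x\<^sup>2) / (2 * pi) * ln (p + 1 / p - x)" for x
  have pos: "p + 1 / p - x > 0" if "x \<le> 2" for x
  proof -
    have "p + 1 / p - 2 = (p - 1)\<^sup>2 / p" using p by (simp add: field_simps power2_eq_square)
    moreover have "(p - 1)\<^sup>2 / p > 0" using p by simp
    ultimately show ?thesis using that by linarith
  qed
  have cont_f: "continuous_on {-2..2} f"
    unfolding f_def using pos by (auto intro!: continuous_intros simp: less_imp_neq[symmetric])
  have "(LINT x|semicircle. ln (p + 1 / p - x)) = (LBINT x. f x * indicator {-2..2} x)"
    unfolding semicircle_def f_def
    by (subst integral_density)
       (auto intro!: Bochner_Integration.integral_cong AE_I2 divide_nonneg_pos
         simp: indicator_def power2_le_iff_abs_le[of 2, simplified])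
  also have "\<dots> = (LBINT t. f (- 2 * cos t) * (2 * sin t) * indicator {0..pi} t)"
  proof -
    have "(LBINT x. f x * indicator {- 2 * cos 0..- 2 * cos pi} x) =
        (LBINT t. f (- 2 * cos t) * (2 * sin t) * indicator {0..pi} t)"
    proof (rule integral_substitution(2))
      show "set_integrable lborel {- 2 * cos 0..- 2 * cos pi} f"
        using borel_integrable_atLeastAtMost'[OF cont_f] by simp
    qed (auto intro!: derivative_eq_intros continuous_intros sin_ge_zero)
    then show ?thesis by simp
  qed
  also have "\<dots> = (LBINT t. (\<Sum>m. (if m = 0 then ln p else - 2 * (- 1 / p) ^ m / m) *
      ((2 / pi * (sin t)\<^sup>2 * cos (real m * t)) * indicator {0..pi} t)))"
    (is "_ = (LBINT t. (\<Sum>m. ?c m * ?F m t))")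
  proof (intro Bochner_Integration.integral_cong refl)
    fix t :: real
    have "f (- 2 * cos t) * (2 * sin t) * indicator {0..pi} t =
       ln (p + 1 / p + 2 * cos t) * (2 / pi * (sin t)\<^sup>2) * indicator {0..pi} t"
    proof (cases "t \<in> {0..pi}")
      case True
      have "4 - (- 2 * cos t)\<^sup>2 = (2 * sin t)\<^sup>2" by (simp add: power_mult_distrib sin_squared_eq)
      then have "sqrt (4 - (- 2 * cos t)\<^sup>2) = 2 * sin t"
        using True by (simp only: real_sqrt_abs) (simp add: sin_ge_zero)
      then show ?thesis by (simp add: f_def power2_eq_square)
    qed simp
    also have "\<dots> = (\<Sum>m. ?c m * ?F m t)"
      using sums_mult2[OF ln_cos_sums[OF p, of t], of "2 / pi * (sin t)\<^sup>2 * indicator {0..pi} t"]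
      by (simp add: sums_iff mult_ac)
    finally show "f (- 2 * cos t) * (2 * sin t) * indicator {0..pi} t = (\<Sum>m. ?c m * ?F m t)" .
  qed
  also have "\<dots> = (\<Sum>m. (LBINT t. ?c m * ?F m t))"
  proof (rule integral_suminf)
    have intF: "integrable lborel (?F m)" for m
      using borel_integrable_atLeastAtMost'[of 0 pi "\<lambda>t. 2 / pi * (sin t)\<^sup>2 * cos (real m * t)"]
      by (simp add: set_integrable_def mult.commute continuous_intros)
    then show "integrable lborel (\<lambda>t. ?c m * ?F m t)" for m by (intro integrable_mult_right)
    define D where "D = \<bar>ln p\<bar> + 2"
    have c: "\<bar>?c m\<bar> \<le> D * (1 / p) ^ m" for m
    proof (cases "m = 0")
      case False
      have "\<bar>?c m\<bar> = 2 * (1 / p) ^ m / m" using False p by (simp add: abs_mult power_abs)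
      also have "\<dots> \<le> 2 * (1 / p) ^ m / 1" using False p by (intro divide_left_mono) auto
      also have "\<dots> \<le> D * (1 / p) ^ m" using p by (simp add: D_def)
      finally show ?thesis .
    qed (simp add: D_def)
    have F: "\<bar>?F m t\<bar> \<le> 2 / pi * indicator {0..pi} t" for m t
    proof -
      have "(sin t)\<^sup>2 * \<bar>cos (real m * t)\<bar> \<le> 1 * 1"
        by (intro mult_mono) (auto simp: abs_square_le_1)
      then show ?thesis by (auto simp: abs_mult indicator_def field_simps)
    qed
    have b: "norm (?c m * ?F m t) \<le> (D * (1 / p) ^ m) * (2 / pi * indicator {0..pi} t)" for m t
      unfolding real_norm_def abs_mult[of "?c m"] by (intro mult_mono c F) (use p in \<open>auto simp: D_def\<close>)
    have geo: "summable (\<lambda>m. D * (1 / p) ^ m * C)" for C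
    proof -
      have "summable (\<lambda>m. (1 / p) ^ m)" using p by (intro summable_geometric) auto
      then show ?thesis by (rule summable_mult2[OF summable_mult])
    qed
    show "AE t in lborel. summable (\<lambda>m. norm (?c m * ?F m t))"
    proof (rule AE_I2)
      fix t :: real
      show "summable (\<lambda>m. norm (?c m * ?F m t))"
      proof (rule summable_comparison_test'[OF geo[of "2 / pi * indicator {0..pi} t"], of 0])
        fix m :: nat
        show "norm (norm (?c m * ?F m t)) \<le> D * (1 / p) ^ m * (2 / pi * indicator {0..pi} t)"
          using b[of m t] by (simp only: real_norm_def abs_idempotent)
      qed
    qed
    show "summable (\<lambda>m. LBINT t. norm (?c m * ?F m t))"
    proof (rule summable_comparison_test'[OF geo, of 0])
      fix m :: nat
      have "(LBINT t. norm (?c m * ?F m t)) \<le> (LBINT t. (D * (1 / p) ^ m) * (2 / pi * indicator {0..pi} t))"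
      proof (rule integral_mono)
        show "integrable lborel (\<lambda>t. norm (?c m * ?F m t))"
          by (rule integrable_norm, rule integrable_mult_right, rule intF)
        show "integrable lborel (\<lambda>t. (D * (1 / p) ^ m) * (2 / pi * indicator {0..pi} t))"
          by (rule integrable_mult_right, rule integrable_mult_right) simp
      qed (rule b)
      also have "\<dots> = (D * (1 / p) ^ m) * (LBINT t. 2 / pi * indicator {0..pi} t)"
        by (rule integral_mult_right_zero)
      also have "(LBINT t. 2 / pi * indicator {0..pi} t) = 2" by simp
      finally have "(LBINT t. norm (?c m * ?F m t)) \<le> D * (1 / p) ^ m * 2" .
      moreover have "(LBINT t. norm (?c m * ?F m t)) \<ge> 0" by (rule integral_nonneg_AE) (intro AE_I2 norm_ge_zero)
      ultimately show "norm (LBINT t. norm (?c m * ?F m t)) \<le> D * (1 / p) ^ m * 2"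
        by (simp only: real_norm_def abs_of_nonneg)
    qed
  qed
  also have "\<dots> = (\<Sum>m. if m = 0 then ln p else if m = 2 then 1 / (2 * p\<^sup>2) else 0)"
    unfolding integral_mult_right_zero integral_sin_squared_cos
    by (intro arg_cong[where f = suminf] ext) (auto simp: power2_eq_square)
  also have "\<dots> = (\<Sum>m\<in>{0, 2::nat}. if m = 0 then ln p else if m = 2 then 1 / (2 * p\<^sup>2) else 0)"
    by (rule suminf_finite) auto
  finally show ?thesis by simp
qed

section \<open>The volume of the unit ball\<close>

lemma ln_Gamma_add_2:
  fixes x :: real assumes "x > 0"
  shows "ln (Gamma (x + 2)) = ln (x + 1) + ln (Gamma (x + 1))"
proof -
  have "Gamma ((x + 1) + 1) = (x + 1) * Gamma (x + 1)"
    using assms by (intro Gamma_plus1) (auto elim!: nonpos_Ints_cases)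
  moreover have "Gamma (x + 1) > 0" using assms by (intro Gamma_real_pos) auto
  ultimately show ?thesis using assms by (simp add: ln_mult_pos add.assoc)
qed

text \<open>
  A weak form of Stirling's formula at the half-integers. Both bounds propagate along
  \<open>\<Gamma>(x + 2) = (x + 1) \<Gamma>(x + 1)\<close> with \<open>x = n / 2\<close>; the constant \<open>C\<close> covers \<open>n = 1\<close> and \<open>n = 2\<close>.
\<close>
lemma ln_Gamma_half_integer_bounds:
  "\<exists>C::real. \<forall>n\<ge>(1::nat). n / 2 * ln (n / 2) - n / 2 - C \<le> ln (Gamma (n / 2 + 1)) \<and>
     ln (Gamma (n / 2 + 1)) \<le> (n / 2 + 1) * ln (n / 2 + 1) - n / 2 + C"
proof -
  define g where "g n = ln (Gamma (real n / 2 + 1))" for n :: nat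
  define C where "C = \<bar>g 1\<bar> + \<bar>g 2\<bar> + 1"
  have bounds: "n / 2 * ln (n / 2) - n / 2 - C \<le> g n \<and> g n \<le> (n / 2 + 1) * ln (n / 2 + 1) - n / 2 + C"
    if "n \<ge> (1::nat)" for n :: nat
    using that
  proof (induction n rule: less_induct)
    case (less n)
    consider "n = 1" | "n = 2" | m where "n = m + 2" "m \<ge> 1"
    proof -
      assume *: "n = 1 \<Longrightarrow> thesis" "n = 2 \<Longrightarrow> thesis" "\<And>m. n = m + 2 \<Longrightarrow> m \<ge> 1 \<Longrightarrow> thesis"
      have "n = 1 \<or> n = 2 \<or> (n = (n - 2) + 2 \<and> n - 2 \<ge> 1)" using less.prems by linarith
      then show thesis using * by blast
    qed
    then show ?case
    proof cases
      case 1
      have "ln (1 / 2 :: real) \<le> 0" "(1 / 2 + 1) * ln (1 / 2 + 1 :: real) \<ge> 0" by auto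
      then have "1 / 2 * ln (1 / 2) - 1 / 2 - C \<le> g 1" "g 1 \<le> (1 / 2 + 1) * ln (1 / 2 + 1) - 1 / 2 + C"
        unfolding C_def by linarith+
      then show ?thesis unfolding 1 by simp
    next
      case 2
      have "ln (2 :: real) \<ge> 0" by simp
      then have "- 1 - C \<le> g 2" "g 2 \<le> 2 * ln 2 - 1 + C"
        unfolding C_def by linarith+
      then show ?thesis unfolding 2 by simp
    next
      case (3 m)
      define x where "x = real m / 2"
      have x: "x > 0" using 3 by (simp add: x_def)
      have xn: "real n / 2 = x + 1" using 3 by (simp add: x_def)
      have gn: "g n = ln (x + 1) + g m"
        using ln_Gamma_add_2[OF x] unfolding g_def xn by (simp add: x_def add.assoc)
      have IH: "x * ln x - x - C \<le> g m" "g m \<le> (x + 1) * ln (x + 1) - x + C"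
        using less.IH[of m] 3 unfolding x_def by auto
      have "ln (1 + 1 / x) \<le> 1 / x"
        using ln_add_one_self_le_self[of "1 / x"] x by simp
      moreover have "1 + 1 / x = (x + 1) / x" using x by (simp add: add_divide_distrib)
      ultimately have "x * ln ((x + 1) / x) \<le> 1" using x by (simp add: pos_le_divide_eq mult.commute)
      then have 1: "x * ln (x + 1) - x * ln x \<le> 1" using x by (simp add: ln_div right_diff_distrib)
      have "ln ((x + 1) / (x + 2)) \<le> (x + 1) / (x + 2) - 1"
        using x by (intro ln_le_minus_one) simp
      also have "\<dots> = - 1 / (x + 2)" using x by (simp add: field_simps)
      finally have "(x + 2) * ln ((x + 1) / (x + 2)) \<le> - 1" using x by (simp add: field_simps)
      then have 2: "(x + 2) * ln (x + 1) - (x + 2) * ln (x + 2) \<le> - 1"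
        using x by (simp add: ln_div right_diff_distrib)
      define l0 l1 l2 where "l0 = ln x" and "l1 = ln (x + 1)" and "l2 = ln (x + 2)"
      have "(x + 1) * l1 - (x + 1) - C \<le> l1 + g m \<and> l1 + g m \<le> (x + 2) * l2 - (x + 1) + C"
        using IH 1 2 unfolding l0_def[symmetric] l1_def[symmetric] l2_def[symmetric] distrib_right
        by linarith
      moreover have "x + 1 + 1 = x + 2" by simp
      ultimately show ?thesis unfolding gn xn l1_def l2_def by (simp only:)
    qed
  qed
  show ?thesis
    by (rule exI[of _ C]) (use bounds[unfolded g_def] in blast)
qed

lemma ln_unit_ball_vol_asymp:
  "(\<lambda>n. ln (unit_ball_vol (real n)) / n + ln n / 2) \<longlonglongrightarrow> (ln (2 * pi) + 1) / 2"
proof -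
  obtain C where C:
    "\<And>n::nat. n \<ge> (1::nat) \<Longrightarrow> n / 2 * ln (n / 2) - n / 2 - C \<le> ln (Gamma (n / 2 + 1))"
    "\<And>n::nat. n \<ge> (1::nat) \<Longrightarrow> ln (Gamma (n / 2 + 1)) \<le> (n / 2 + 1) * ln (n / 2 + 1) - n / 2 + C"
    using ln_Gamma_half_integer_bounds by metis
  have l: "(\<lambda>n::nat. (n / 2 * ln (n / 2) - n / 2 - C) / n - ln n / 2) \<longlonglongrightarrow> ln (1 / 2) / 2 - 1 / 2"
    and u: "(\<lambda>n::nat. ((n / 2 + 1) * ln (n / 2 + 1) - n / 2 + C) / n - ln n / 2) \<longlonglongrightarrow> ln (1 / 2) / 2 - 1 / 2"
    by real_asymp+
  have "(\<lambda>n::nat. ln (Gamma (n / 2 + 1)) / n - ln n / 2) \<longlonglongrightarrow> ln (1 / 2) / 2 - 1 / 2"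
  proof (rule tendsto_sandwich[OF _ _ l u])
    show "\<forall>\<^sub>F n::nat in sequentially. (n / 2 * ln (n / 2) - n / 2 - C) / n - ln n / 2
        \<le> ln (Gamma (n / 2 + 1)) / n - ln n / 2"
      using eventually_ge_at_top[of 1]
      by eventually_elim (use C(1) in \<open>auto intro!: divide_right_mono\<close>)
    show "\<forall>\<^sub>F n::nat in sequentially. ln (Gamma (n / 2 + 1)) / n - ln n / 2
        \<le> ((n / 2 + 1) * ln (n / 2 + 1) - n / 2 + C) / n - ln n / 2"
      using eventually_ge_at_top[of 1]
      by eventually_elim (use C(2) in \<open>auto intro!: divide_right_mono\<close>)
  qed
  then have "(\<lambda>n::nat. ln pi / 2 - (ln (Gamma (n / 2 + 1)) / n - ln n / 2)) \<longlonglongrightarrow> ln pi / 2 - (ln (1 / 2) / 2 - 1 / 2)"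
    by (rule tendsto_diff[OF tendsto_const])
  moreover have "\<forall>\<^sub>F n::nat in sequentially. ln pi / 2 - (ln (Gamma (n / 2 + 1)) / n - ln n / 2)
      = ln (unit_ball_vol (real n)) / n + ln n / 2"
    using eventually_ge_at_top[of 1]
  proof eventually_elim
    case (elim n)
    have "Gamma (real n / 2 + 1) > 0" by (intro Gamma_real_pos) (simp add: add_nonneg_pos)
    then have "ln (unit_ball_vol (real n)) = n / 2 * ln pi - ln (Gamma (n / 2 + 1))"
      unfolding unit_ball_vol_def by (subst ln_divide_pos) (simp_all add: ln_powr)
    then show ?case using elim by (simp add: diff_divide_distrib)
  qed
  moreover have "ln pi / 2 - (ln (1 / 2) / 2 - 1 / 2) = (ln (2 * pi) + 1) / 2"
    by (simp add: ln_mult ln_div add_divide_distrib)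
  ultimately show ?thesis by (simp only: tendsto_cong)
qed

section \<open>Comparison of the partition function with Gaussian integrals\<close>

abbreviation lebesgue_prod :: "nat \<Rightarrow> (nat \<Rightarrow> real) measure" where
  "lebesgue_prod n \<equiv> \<Pi>\<^sub>M i\<in>{..<n}. lborel"

text \<open>The total mass of \<open>exp (- c x\<^sup>T B x)\<close> on \<open>\<real>\<^sup>n\<close> for a positive definite \<open>B\<close>.\<close>
definition gauss_mass :: "nat \<Rightarrow> real \<Rightarrow> real mat \<Rightarrow> real" where
  "gauss_mass n c B = sqrt ((pi / c) ^ n / det B)"

lemma measurable_bil [measurable]:
  assumes [measurable]: "\<And>i. i < n \<Longrightarrow> (\<lambda>x. f x i) \<in> borel_measurable M"
    "\<And>i. i < n \<Longrightarrow> (\<lambda>x. g x i) \<in> borel_measurable M"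
  shows "(\<lambda>x. bil n B (f x) (g x)) \<in> borel_measurable M"
  unfolding bil_def by measurable

lemma measurable_sqnorm [measurable]:
  assumes [measurable]: "\<And>i. i < n \<Longrightarrow> (\<lambda>x. f x i) \<in> borel_measurable M"
  shows "(\<lambda>x. sqnorm n (f x)) \<in> borel_measurable M"
  unfolding sqnorm_def by measurable

lemma measurable_coordinate [measurable]:
  "i < n \<Longrightarrow> (\<lambda>x. x i) \<in> borel_measurable (lebesgue_prod n)"
  "i < n \<Longrightarrow> (\<lambda>x. x i) \<in> borel_measurable (\<Pi>\<^sub>M i\<in>{..<n}. borel :: real measure)"
  by (simp_all add: measurable_component_singleton[of i "{..<n}" "\<lambda>_. lborel", simplified])

lemma gauss_mass_integral:
  assumes B: "real_symmetric n B" "pos_def n B" and c: "c > 0"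
  shows "(\<integral>\<^sup>+x. ennreal (exp (- c * bil n B (\<lambda>i. x i - u i) (\<lambda>i. x i - u i))) \<partial>lebesgue_prod n)
    = ennreal (gauss_mass n c B)"
proof -
  have Bc: "B \<in> carrier_mat n n" using B by (simp add: real_symmetric_def)
  have b: "bil n (c \<cdot>\<^sub>m B) x y = c * bil n B x y" for x y
    using Bc unfolding bil_def sum_distrib_left by (intro sum.cong refl) (auto simp: mult.assoc)
  have "B $$ (i, j) = B $$ (j, i)" if "i < n" "j < n" for i j
    using real_symmetric_entry[OF B(1)] that by blast
  then have "real_symmetric n (c \<cdot>\<^sub>m B)"
    using Bc unfolding real_symmetric_def by (auto intro!: eq_matI)
  moreover have "pos_def n (c \<cdot>\<^sub>m B)" using B(2) c unfolding pos_def_def b by simp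
  ultimately have "(\<integral>\<^sup>+x. ennreal (exp (- (c * bil n B (\<lambda>i. x i - u i) (\<lambda>i. x i - u i)))) \<partial>lebesgue_prod n)
    = ennreal (sqrt (pi ^ n / det (c \<cdot>\<^sub>m B)))"
    using pos_def_gaussian[of n "c \<cdot>\<^sub>m B" u] unfolding b by blast
  also have "pi ^ n / det (c \<cdot>\<^sub>m B) = (pi / c) ^ n / det B"
    using Bc by (simp add: det_smult power_divide)
  finally show ?thesis by (simp add: gauss_mass_def)
qed

lemma shifted_det_pos:
  assumes "real_symmetric n A" "\<gamma> > eigval A 1"
  shows "det (shifted n \<gamma> A) > 0"
  using pos_def_gaussian[OF real_symmetric_shifted pos_def_shifted] assms by blast

lemma hamiltonian_eq_bil:
  assumes "A \<in> carrier_mat n n"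
  shows "hamiltonian n A \<sigma> = real n / 2 * bil n A \<sigma> \<sigma>"
proof -
  have "scalar_prod (Matrix.vec n \<sigma>) (mult_mat_vec A (Matrix.vec n \<sigma>)) = bil n A \<sigma> \<sigma>"
    using assms unfolding bil_def scalar_prod_def
    by (auto simp: scalar_prod_def sum_distrib_left lessThan_atLeast0 mult_ac intro!: sum.cong)
  then show ?thesis by (simp add: hamiltonian_def)
qed

text \<open>
  The integral over the punctured unit ball of \<open>exp (\<beta> H)\<close>, evaluated at the direction \<open>x / |x|\<close>.
  It is the partition function times the volume of the ball.
\<close>
definition cone_integral :: "nat \<Rightarrow> real mat \<Rightarrow> real \<Rightarrow> ennreal" where
  "cone_integral n A \<beta> = (\<integral>\<^sup>+x. ennreal (exp (real n * \<beta> / 2 * (bil n A x x / sqnorm n x))) *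
     indicator {x. 0 < sqnorm n x \<and> sqnorm n x \<le> 1} x \<partial>lebesgue_prod n)"

lemma partition_function_eq:
  assumes A: "A \<in> carrier_mat n n" and n: "n \<ge> 1"
  shows "partition_function n A \<beta> = enn2real (cone_integral n A \<beta> / ennreal (unit_ball_vol n))"
proof -
  define T where "T x = (\<lambda>i\<in>{..<n}. x i / L2_set x {..<n})" for x :: "nat \<Rightarrow> real"
  define P where "P = (\<Pi>\<^sub>M i\<in>{..<n}. borel :: real measure)"
  have spP: "space P = {..<n} \<rightarrow>\<^sub>E UNIV" by (simp add: P_def space_PiM)
  have spL: "space (lebesgue_prod n) = {..<n} \<rightarrow>\<^sub>E UNIV" by (simp add: space_PiM)
  have coordP [measurable]: "i < n \<Longrightarrow> (\<lambda>x. x i) \<in> borel_measurable P" for i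
    unfolding P_def by measurable
  have "{x \<in> space P. sqnorm n x = 1} \<in> sets P" by measurable
  also have "{x \<in> space P. sqnorm n x = 1} = unit_sphere n"
    by (auto simp: spP unit_sphere_def sqnorm_def)
  finally have sphere [measurable]: "unit_sphere n \<in> sets P" .
  have "{x \<in> space (lebesgue_prod n). sqnorm n x \<le> 1} \<in> sets (lebesgue_prod n)" by measurable
  also have "{x \<in> space (lebesgue_prod n). sqnorm n x \<le> 1} = unit_ball n"
    unfolding spL by (auto simp: unit_ball_def sqnorm_def)
  finally have ball [measurable]: "unit_ball n \<in> sets (lebesgue_prod n)" .
  have "unit_ball n = {f. sqrt (\<Sum>i\<in>{..<n}. (f i)\<^sup>2) \<le> 1} \<inter> space (lebesgue_prod n)"
    unfolding spL by (auto simp: unit_ball_def)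
  then have vol: "emeasure (lebesgue_prod n) (unit_ball n) = ennreal (unit_ball_vol n)"
    using emeasure_cball_aux[of "{..<n}" 1] by simp
  have T_meas: "T \<in> measurable (lebesgue_prod n) P"
    unfolding T_def P_def L2_set_def by measurable
  have [measurable]: "T \<in> measurable (uniform_measure (lebesgue_prod n) (unit_ball n)) P"
    using T_meas by (subst measurable_cong_sets[OF sets_uniform_measure refl])
  have mu: "sphere_measure n = distr (uniform_measure (lebesgue_prod n) (unit_ball n)) P T"
  proof -
    have "T = (\<lambda>x. \<lambda>i\<in>{..<n}. x i / L2_set x {..<n})" by (rule ext) (rule T_def)
    then show ?thesis by (simp only: sphere_measure_def P_def)
  qed
  define f where "f \<sigma> = indicator (unit_sphere n) \<sigma> * exp (\<beta> * hamiltonian n A \<sigma>)" for \<sigma>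
  have f [measurable]: "f \<in> borel_measurable P"
    unfolding f_def hamiltonian_eq_bil[OF A] by measurable
  \<comment> \<open>The centre of the ball is sent to \<open>0\<close>, which is not on the sphere.\<close>
  have sT: "sqnorm n (T x) = (if sqnorm n x > 0 then 1 else 0)" for x
  proof -
    have "sqnorm n (T x) = (\<Sum>i<n. (x i)\<^sup>2 / sqnorm n x)"
      unfolding sqnorm_def T_def L2_set_def by (simp add: power_divide sum_nonneg)
    also have "\<dots> = sqnorm n x / sqnorm n x" by (simp only: sqnorm_def sum_divide_distrib[symmetric])
    finally show ?thesis using sqnorm_nonneg[of n x] by (cases "sqnorm n x = 0") (simp_all add: less_le)
  qed
  have bT: "bil n A (T x) (T x) = bil n A x x / sqnorm n x" for x
  proof -
    have "bil n A (T x) (T x) = (\<Sum>i<n. \<Sum>j<n. A $$ (i, j) * x i * x j / sqnorm n x)"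
      unfolding bil_def T_def L2_set_def sqnorm_def
      by (intro sum.cong refl) (simp add: sum_nonneg)
    then show ?thesis by (simp add: bil_def sum_divide_distrib)
  qed
  have "partition_function n A \<beta> = (LINT \<sigma>|sphere_measure n. f \<sigma>)"
    by (simp add: partition_function_def set_lebesgue_integral_def f_def)
  also have "\<dots> = enn2real (\<integral>\<^sup>+\<sigma>. ennreal (f \<sigma>) \<partial>sphere_measure n)"
    by (rule integral_eq_nn_integral) (auto simp: mu f_def[abs_def, symmetric], auto simp: f_def)
  also have "(\<integral>\<^sup>+\<sigma>. ennreal (f \<sigma>) \<partial>sphere_measure n) =
      (\<integral>\<^sup>+x. ennreal (f (T x)) \<partial>uniform_measure (lebesgue_prod n) (unit_ball n))"
    unfolding mu by (rule nn_integral_distr) auto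
  also have "\<dots> = (\<integral>\<^sup>+x. ennreal (f (T x)) * indicator (unit_ball n) x \<partial>lebesgue_prod n) /
      ennreal (unit_ball_vol n)"
    using T_meas by (subst nn_integral_uniform_measure) (auto simp: vol)
  also have "(\<integral>\<^sup>+x. ennreal (f (T x)) * indicator (unit_ball n) x \<partial>lebesgue_prod n) = cone_integral n A \<beta>"
    unfolding cone_integral_def
  proof (rule nn_integral_cong)
    fix x assume x: "x \<in> space (lebesgue_prod n)"
    have "T x \<in> {..<n} \<rightarrow>\<^sub>E UNIV" by (simp add: T_def)
    then have "T x \<in> unit_sphere n \<longleftrightarrow> sqnorm n x > 0"
      unfolding unit_sphere_def sqnorm_def[symmetric] mem_Collect_eq sT by simp
    moreover have "x \<in> unit_ball n \<longleftrightarrow> sqnorm n x \<le> 1"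
      using x unfolding spL by (auto simp: unit_ball_def sqnorm_def)
    ultimately show "ennreal (f (T x)) * indicator (unit_ball n) x =
      ennreal (exp (real n * \<beta> / 2 * (bil n A x x / sqnorm n x))) *
      indicator {x. 0 < sqnorm n x \<and> sqnorm n x \<le> 1} x"
      by (auto simp: f_def indicator_def hamiltonian_eq_bil[OF A] bT)
  qed
  finally show ?thesis .
qed

text \<open>
  On the ball, \<open>x\<^sup>T (\<gamma> I - A) x\<close> is at most its value at the direction \<open>x / |x|\<close>, which is
  \<open>\<gamma>\<close> minus the Rayleigh quotient.
\<close>
lemma cone_integral_upper:
  assumes A: "real_symmetric n A" and \<gamma>: "\<gamma> > eigval A 1" and \<beta>: "\<beta> > 0" and n: "n \<ge> 1"
  shows "cone_integral n A \<beta> \<le>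
    ennreal (exp (real n * \<beta> / 2 * \<gamma>) * gauss_mass n (real n * \<beta> / 2) (shifted n \<gamma> A))"
proof -
  let ?c = "real n * \<beta> / 2" and ?B = "shifted n \<gamma> A"
  have Ac: "A \<in> carrier_mat n n" using A by (simp add: real_symmetric_def)
  have c: "?c > 0" using \<beta> n by simp
  have "cone_integral n A \<beta> \<le> (\<integral>\<^sup>+x. ennreal (exp (?c * \<gamma>)) * ennreal (exp (- ?c * bil n ?B x x)) \<partial>lebesgue_prod n)"
    unfolding cone_integral_def
  proof (rule nn_integral_mono)
    fix x
    show "ennreal (exp (?c * (bil n A x x / sqnorm n x))) *
        indicator {x. 0 < sqnorm n x \<and> sqnorm n x \<le> 1} x
      \<le> ennreal (exp (?c * \<gamma>)) * ennreal (exp (- ?c * bil n ?B x x))"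
    proof (cases "0 < sqnorm n x \<and> sqnorm n x \<le> 1")
      case True
      have pos: "bil n ?B x x \<ge> 0"
        using True pos_def_shifted[OF A \<gamma>] unfolding pos_def_def sqnorm_pos_iff by force
      have "bil n ?B x x \<le> bil n ?B x x / sqnorm n x"
        using True pos by (simp add: le_divide_eq mult_left_le)
      also have "\<dots> = \<gamma> - bil n A x x / sqnorm n x"
        using True by (simp add: bil_shifted_self[OF Ac] diff_divide_distrib)
      finally have "?c * (bil n A x x / sqnorm n x) \<le> ?c * (\<gamma> - bil n ?B x x)"
        using c by (intro mult_left_mono) auto
      then show ?thesis using True
        by (simp add: ennreal_mult[symmetric] exp_add[symmetric] algebra_simps)
    qed auto
  qed
  also have "\<dots> = ennreal (exp (?c * \<gamma>)) * (\<integral>\<^sup>+x. ennreal (exp (- ?c * bil n ?B x x)) \<partial>lebesgue_prod n)"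
    by (rule nn_integral_cmult) measurable
  also have "(\<integral>\<^sup>+x. ennreal (exp (- ?c * bil n ?B x x)) \<partial>lebesgue_prod n) = ennreal (gauss_mass n ?c ?B)"
    using gauss_mass_integral[OF real_symmetric_shifted[OF A] pos_def_shifted[OF A \<gamma>] c, of "\<lambda>_. 0"] by simp
  finally show ?thesis by (simp add: ennreal_mult')
qed

text \<open>Translation of the form of \<open>\<theta> I - A\<close> along a unit eigenvector \<open>v\<close> with eigenvalue \<open>l\<close>.\<close>
lemma bil_shifted_translate:
  assumes A: "real_symmetric n A"
    and v: "sqnorm n v = 1" "\<And>x. bil n A x v = l * (\<Sum>i<n. x i * v i)"
  shows "bil n (shifted n \<theta> A) (\<lambda>i. x i - b * v i) (\<lambda>i. x i - b * v i) =
      \<theta> * sqnorm n x - bil n A x x - 2 * b * (\<theta> - l) * (\<Sum>i<n. x i * v i) + b\<^sup>2 * (\<theta> - l)"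
proof -
  let ?B = "shifted n \<theta> A"
  have Ac: "A \<in> carrier_mat n n" using A by (simp add: real_symmetric_def)
  have "(\<Sum>i<n. v i * v i) = 1" using v(1) by (simp add: sqnorm_def power2_eq_square)
  then have vv: "bil n ?B v v = \<theta> - l" by (simp add: bil_shifted[OF Ac] v(2))
  have xv: "bil n ?B x v = (\<theta> - l) * (\<Sum>i<n. x i * v i)"
    by (simp add: bil_shifted[OF Ac] v(2) algebra_simps)
  have vx: "bil n ?B v x = (\<theta> - l) * (\<Sum>i<n. x i * v i)"
    using xv bil_commute[OF real_symmetric_shifted[OF A]] by metis
  have "bil n ?B (\<lambda>i. x i - b * v i) (\<lambda>i. x i - b * v i) =
      bil n ?B x x - b * bil n ?B x v - b * bil n ?B v x + b\<^sup>2 * bil n ?B v v"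
    by (simp add: bil_diff_left bil_diff_right bil_scale_left bil_scale_right
        algebra_simps power2_eq_square)
  then show ?thesis unfolding vv xv vx bil_shifted_self[OF Ac, of \<theta> x] by (simp add: algebra_simps)
qed

text \<open>
  A Chernoff bound for the squared norm under the Gaussian weight of \<open>\<gamma> I - A\<close> centred at \<open>s v\<close>, with
  \<open>v\<close> a unit top eigenvector. Tilting by \<open>exp (c (\<gamma> - \<rho>) |x|\<^sup>2)\<close> turns the weight into the one of
  \<open>\<rho> I - A\<close>, centred at another multiple of \<open>v\<close>, so the tilted integral is again explicit.
  The event is an upper tail for \<open>\<rho> < \<gamma>\<close> and a lower tail for \<open>\<rho> > \<gamma>\<close>.
\<close>
lemma shifted_gauss_tail:
  assumes A: "real_symmetric n A" and \<gamma>: "\<gamma> > eigval A 1" and \<rho>: "\<rho> > eigval A 1" and c: "c > 0"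
    and v: "sqnorm n v = 1" "\<And>x. bil n A x v = eigval A 1 * (\<Sum>i<n. x i * v i)"
  shows "(\<integral>\<^sup>+x. ennreal (exp (- c * bil n (shifted n \<gamma> A) (\<lambda>i. x i - s * v i) (\<lambda>i. x i - s * v i))) *
      indicator {x. (\<gamma> - \<rho>) * (sqnorm n x - \<kappa>) \<ge> 0} x \<partial>lebesgue_prod n) \<le>
    ennreal (exp (c * (\<gamma> - \<rho>) * (s\<^sup>2 * (\<gamma> - eigval A 1) / (\<rho> - eigval A 1) - \<kappa>)) *
      gauss_mass n c (shifted n \<rho> A))"
proof -
  let ?l = "eigval A 1" and ?E = "c * (\<gamma> - \<rho>) * (s\<^sup>2 * (\<gamma> - eigval A 1) / (\<rho> - eigval A 1) - \<kappa>)"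
  \<comment> \<open>The centre after tilting is \<open>a v\<close>.\<close>
  define a where "a = s * (\<gamma> - ?l) / (\<rho> - ?l)"
  have Ac: "A \<in> carrier_mat n n" using A by (simp add: real_symmetric_def)
  note expand = bil_shifted_translate[OF A v]
  have sq: "bil n (shifted n \<gamma> A) (\<lambda>i. x i - s * v i) (\<lambda>i. x i - s * v i) - (\<gamma> - \<rho>) * (sqnorm n x - \<kappa>) =
      bil n (shifted n \<rho> A) (\<lambda>i. x i - a * v i) (\<lambda>i. x i - a * v i) - ?E / c" for x
  proof -
    have 1: "a * (\<rho> - ?l) = s * (\<gamma> - ?l)" using \<rho> by (simp add: a_def)
    have 2: "a\<^sup>2 * (\<rho> - ?l) = s\<^sup>2 * (\<gamma> - ?l)\<^sup>2 / (\<rho> - ?l)"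
      using \<rho> by (simp add: a_def power_divide power2_eq_square)
    have 3: "?E / c = s\<^sup>2 * (\<gamma> - ?l)\<^sup>2 / (\<rho> - ?l) - s\<^sup>2 * (\<gamma> - ?l) - (\<gamma> - \<rho>) * \<kappa>"
    proof -
      define g r where "g = \<gamma> - ?l" and "r = \<rho> - ?l"
      have r: "r \<noteq> 0" and gr: "\<gamma> - \<rho> = g - r" using \<rho> by (simp_all add: g_def r_def)
      have "?E / c = (g - r) * (s\<^sup>2 * g / r - \<kappa>)" using c by (simp add: g_def r_def)
      also have "\<dots> = s\<^sup>2 * g\<^sup>2 / r - s\<^sup>2 * g - (g - r) * \<kappa>"
        using r by (simp add: field_simps power2_eq_square)
      finally show ?thesis unfolding gr[symmetric] unfolding g_def r_def .
    qed
    have 4: "2 * a * (\<rho> - ?l) = 2 * s * (\<gamma> - ?l)" using 1 by simp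
    show ?thesis unfolding expand 2 3 4 by (simp add: algebra_simps)
  qed
  have "(\<integral>\<^sup>+x. ennreal (exp (- c * bil n (shifted n \<gamma> A) (\<lambda>i. x i - s * v i) (\<lambda>i. x i - s * v i))) *
      indicator {x. (\<gamma> - \<rho>) * (sqnorm n x - \<kappa>) \<ge> 0} x \<partial>lebesgue_prod n) \<le>
     (\<integral>\<^sup>+x. ennreal (exp ?E) *
       ennreal (exp (- c * bil n (shifted n \<rho> A) (\<lambda>i. x i - a * v i) (\<lambda>i. x i - a * v i))) \<partial>lebesgue_prod n)"
  proof (rule nn_integral_mono)
    fix x
    let ?Q = "bil n (shifted n \<gamma> A) (\<lambda>i. x i - s * v i) (\<lambda>i. x i - s * v i)"
    let ?R = "bil n (shifted n \<rho> A) (\<lambda>i. x i - a * v i) (\<lambda>i. x i - a * v i)"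
    have "- c * ?Q \<le> ?E + - c * ?R" if "(\<gamma> - \<rho>) * (sqnorm n x - \<kappa>) \<ge> 0"
    proof -
      have "c * (?R - ?E / c) \<le> c * ?Q" using sq[of x] that c by (intro mult_left_mono) auto
      moreover have "c * (x - e / c) = c * x - e" for x e using c by (simp add: right_diff_distrib)
      ultimately have "c * ?R - ?E \<le> c * ?Q" by (simp only:)
      then show ?thesis by linarith
    qed
    then show "ennreal (exp (- c * ?Q)) * indicator {x. (\<gamma> - \<rho>) * (sqnorm n x - \<kappa>) \<ge> 0} x
        \<le> ennreal (exp ?E) * ennreal (exp (- c * ?R))"
      by (auto simp: indicator_def ennreal_mult[symmetric] exp_add[symmetric])
  qed
  also have "\<dots> = ennreal (exp ?E) * (\<integral>\<^sup>+x.
       ennreal (exp (- c * bil n (shifted n \<rho> A) (\<lambda>i. x i - a * v i) (\<lambda>i. x i - a * v i))) \<partial>lebesgue_prod n)"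
    by (rule nn_integral_cmult) measurable
  also have "\<dots> = ennreal (exp ?E) * ennreal (gauss_mass n c (shifted n \<rho> A))"
    by (subst gauss_mass_integral[OF real_symmetric_shifted[OF A] pos_def_shifted[OF A \<rho>] c]) simp
  finally show ?thesis by (simp add: ennreal_mult')
qed

text \<open>
  The lower bound restricts to the shell \<open>1 - \<delta> \<le> |x|\<^sup>2 \<le> 1\<close>. As \<open>eigval A 1 * I - A\<close> annihilates the
  top eigenvector \<open>v\<close>, its form at \<open>x\<close> equals its form at \<open>x - s v\<close>, which is at most that of
  \<open>\<gamma> I - A\<close>; dividing by \<open>|x|\<^sup>2\<close> costs the factor \<open>1 / (1 - \<delta>)\<close> in \<open>c\<close>. The shifted Gaussian weight so
  obtained may be integrated over the whole space, up to the two tails outside the shell.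
\<close>
lemma cone_integral_lower:
  fixes \<beta> \<gamma> \<delta> \<rho>1 \<rho>2 s :: real
  assumes A: "real_symmetric n A" and \<beta>: "\<beta> > 0" and n: "n \<ge> 1" and \<delta>: "0 < \<delta>" "\<delta> < 1"
    and \<rho>1: "eigval A 1 < \<rho>1" "\<rho>1 < \<gamma>" and \<rho>2: "\<gamma> < \<rho>2"
  defines "c \<equiv> real n * \<beta> / 2 / (1 - \<delta>)"
  defines "E \<equiv> \<lambda>\<rho> \<kappa>. exp (c * (\<gamma> - \<rho>) * (s\<^sup>2 * (\<gamma> - eigval A 1) / (\<rho> - eigval A 1) - \<kappa>)) *
      gauss_mass n c (shifted n \<rho> A)"
  shows "ennreal (exp (real n * \<beta> / 2 * eigval A 1) *
      (gauss_mass n c (shifted n \<gamma> A) - (E \<rho>1 1 + E \<rho>2 (1 - \<delta>)))) \<le> cone_integral n A \<beta>"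
proof -
  let ?l = "eigval A 1" and ?d = "real n * \<beta> / 2"
  have Ac: "A \<in> carrier_mat n n" using A by (simp add: real_symmetric_def)
  have d: "?d > 0" using \<beta> n by simp
  have c: "c > 0" unfolding c_def using d \<delta> by simp
  have \<gamma>: "\<gamma> > ?l" using \<rho>1 by simp
  obtain v where v: "sqnorm n v = 1" "\<And>x. bil n A x v = ?l * (\<Sum>i<n. x i * v i)"
    using unit_top_eigenvector[OF A n] by metis
  define W where "W x = exp (- c * bil n (shifted n \<gamma> A) (\<lambda>i. x i - s * v i) (\<lambda>i. x i - s * v i))" for x
  define S where "S = (\<integral>\<^sup>+x. ennreal (W x) * indicator {x. 1 - \<delta> \<le> sqnorm n x \<and> sqnorm n x \<le> 1} x \<partial>lebesgue_prod n)"
  have W [measurable]: "W \<in> borel_measurable (lebesgue_prod n)" unfolding W_def by measurable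
  have meas: "(\<lambda>x. ennreal (W x) * indicator {x. P x} x) \<in> borel_measurable (lebesgue_prod n)"
    if [measurable]: "Measurable.pred (lebesgue_prod n) P" for P
    by measurable
  have E_nonneg: "E \<rho> \<kappa> \<ge> 0" if "\<rho> > ?l" for \<rho> \<kappa>
    unfolding E_def gauss_mass_def using shifted_det_pos[OF A that] c by simp
  have tail: "(\<integral>\<^sup>+x. ennreal (W x) * indicator {x. (\<gamma> - \<rho>) * (sqnorm n x - \<kappa>) \<ge> 0} x \<partial>lebesgue_prod n)
      \<le> ennreal (E \<rho> \<kappa>)" if "\<rho> > ?l" for \<rho> \<kappa>
    unfolding W_def E_def by (rule shifted_gauss_tail[OF A \<gamma> that c v])
  have "ennreal (gauss_mass n c (shifted n \<gamma> A)) = (\<integral>\<^sup>+x. ennreal (W x) \<partial>lebesgue_prod n)"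
    unfolding W_def
    by (rule gauss_mass_integral[OF real_symmetric_shifted[OF A] pos_def_shifted[OF A \<gamma>] c, symmetric])
  also have "\<dots> \<le> (\<integral>\<^sup>+x. ennreal (W x) * indicator {x. 1 - \<delta> \<le> sqnorm n x \<and> sqnorm n x \<le> 1} x +
      (ennreal (W x) * indicator {x. (\<gamma> - \<rho>1) * (sqnorm n x - 1) \<ge> 0} x +
       ennreal (W x) * indicator {x. (\<gamma> - \<rho>2) * (sqnorm n x - (1 - \<delta>)) \<ge> 0} x) \<partial>lebesgue_prod n)"
  proof (rule nn_integral_mono)
    fix x
    have "1 - \<delta> \<le> sqnorm n x \<and> sqnorm n x \<le> 1 \<or> (\<gamma> - \<rho>1) * (sqnorm n x - 1) \<ge> 0 \<or>
        (\<gamma> - \<rho>2) * (sqnorm n x - (1 - \<delta>)) \<ge> 0"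
      using \<rho>1 \<rho>2 by (auto simp: zero_le_mult_iff)
    then show "ennreal (W x) \<le> ennreal (W x) * indicator {x. 1 - \<delta> \<le> sqnorm n x \<and> sqnorm n x \<le> 1} x +
      (ennreal (W x) * indicator {x. (\<gamma> - \<rho>1) * (sqnorm n x - 1) \<ge> 0} x +
       ennreal (W x) * indicator {x. (\<gamma> - \<rho>2) * (sqnorm n x - (1 - \<delta>)) \<ge> 0} x)"
      by (auto simp: indicator_def add_increasing add_increasing2)
  qed
  also have "\<dots> = S + ((\<integral>\<^sup>+x. ennreal (W x) * indicator {x. (\<gamma> - \<rho>1) * (sqnorm n x - 1) \<ge> 0} x \<partial>lebesgue_prod n)
     + (\<integral>\<^sup>+x. ennreal (W x) * indicator {x. (\<gamma> - \<rho>2) * (sqnorm n x - (1 - \<delta>)) \<ge> 0} x \<partial>lebesgue_prod n))"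
    unfolding S_def by (subst nn_integral_add[OF meas borel_measurable_add[OF meas meas]],
        simp, simp, simp, subst nn_integral_add[OF meas meas]) simp_all
  also have "\<dots> \<le> S + (ennreal (E \<rho>1 1) + ennreal (E \<rho>2 (1 - \<delta>)))"
    using \<rho>1 \<rho>2 by (intro add_mono tail order.refl) auto
  also have "\<dots> = ennreal (E \<rho>1 1 + E \<rho>2 (1 - \<delta>)) + S"
    using E_nonneg \<rho>1 \<rho>2 by (simp add: add.commute)
  finally have "ennreal (gauss_mass n c (shifted n \<gamma> A) - (E \<rho>1 1 + E \<rho>2 (1 - \<delta>))) \<le> S"
    using E_nonneg \<rho>1 \<rho>2
    by (subst ennreal_minus[symmetric]) (auto simp: ennreal_minus_le_iff intro!: add_nonneg_nonneg)
  then have "ennreal (exp (?d * ?l) * (gauss_mass n c (shifted n \<gamma> A) - (E \<rho>1 1 + E \<rho>2 (1 - \<delta>))))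
      \<le> ennreal (exp (?d * ?l)) * S"
    by (subst ennreal_mult') (auto intro: mult_left_mono)
  also have "\<dots> = (\<integral>\<^sup>+x. ennreal (exp (?d * ?l)) * (ennreal (W x) *
      indicator {x. 1 - \<delta> \<le> sqnorm n x \<and> sqnorm n x \<le> 1} x) \<partial>lebesgue_prod n)"
    unfolding S_def by (rule nn_integral_cmult[symmetric]) measurable
  also have "\<dots> \<le> cone_integral n A \<beta>"
    unfolding cone_integral_def
  proof (rule nn_integral_mono)
    fix x
    let ?y = "\<lambda>i. x i - s * v i"
    show "ennreal (exp (?d * ?l)) * (ennreal (W x) *
        indicator {x. 1 - \<delta> \<le> sqnorm n x \<and> sqnorm n x \<le> 1} x)
      \<le> ennreal (exp (?d * (bil n A x x / sqnorm n x))) * indicator {x. 0 < sqnorm n x \<and> sqnorm n x \<le> 1} x"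
    proof (cases "1 - \<delta> \<le> sqnorm n x \<and> sqnorm n x \<le> 1")
      case True
      \<comment> \<open>The deficit of \<open>x\<close> with respect to the top eigenvalue.\<close>
      define P where "P = ?l * sqnorm n x - bil n A x x"
      have pos: "sqnorm n x > 0" using True \<delta> by linarith
      have P: "P \<ge> 0" unfolding P_def using bil_le_eigval_1[OF A, of x] by simp
      have "P = bil n (shifted n ?l A) ?y ?y"
        unfolding bil_shifted_translate[OF A v] P_def by simp
      also have "\<dots> \<le> bil n (shifted n \<gamma> A) ?y ?y"
        unfolding bil_shifted_self[OF Ac] using \<gamma> by (simp add: mult_right_mono)
      finally have PQ: "P \<le> bil n (shifted n \<gamma> A) ?y ?y" .
      have "P / sqnorm n x \<le> P / (1 - \<delta>)" using True \<delta> P pos by (intro divide_left_mono) auto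
      also have "\<dots> \<le> bil n (shifted n \<gamma> A) ?y ?y / (1 - \<delta>)" using PQ \<delta> by (intro divide_right_mono) auto
      finally have "?l - bil n (shifted n \<gamma> A) ?y ?y / (1 - \<delta>) \<le> ?l - P / sqnorm n x" by simp
      also have "\<dots> = bil n A x x / sqnorm n x" using pos by (simp add: P_def diff_divide_distrib)
      finally have "?d * (?l - bil n (shifted n \<gamma> A) ?y ?y / (1 - \<delta>)) \<le> ?d * (bil n A x x / sqnorm n x)"
        using d by (intro mult_left_mono) auto
      moreover have "?d * (?l - bil n (shifted n \<gamma> A) ?y ?y / (1 - \<delta>)) =
          ?d * ?l + - c * bil n (shifted n \<gamma> A) ?y ?y"
        unfolding c_def by (simp add: right_diff_distrib)
      ultimately have "?d * ?l + - c * bil n (shifted n \<gamma> A) ?y ?y \<le> ?d * (bil n A x x / sqnorm n x)"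
        by linarith
      then have "exp (?d * ?l) * W x \<le> exp (?d * (bil n A x x / sqnorm n x))"
        unfolding W_def exp_add[symmetric] exp_le_cancel_iff .
      then show ?thesis using True pos
        by (simp add: ennreal_mult'[symmetric] W_def)
    qed auto
  qed
  finally show ?thesis .
qed

section \<open>Limit of the logarithmic determinants and the Chernoff rate\<close>

text \<open>
  The position of the outlier produced by a spike of strength \<open>p\<close>. It parametrises the half-line above
  \<open>2\<close> by \<open>p > 1\<close>, and makes the logarithmic potential of the semicircle law elementary.
\<close>
definition outlier :: "real \<Rightarrow> real" where
  "outlier p = p + 1 / p"

text \<open>
  The logarithmic potential of the semicircle law, as a function of \<open>p\<close>: the integral of
  \<open>ln (outlier p - x)\<close>.
\<close>
definition log_potential :: "real \<Rightarrow> real" where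
  "log_potential p = ln p + 1 / (2 * p\<^sup>2)"

lemma outlier_strict_mono:
  assumes "1 \<le> p" "p < r"
  shows "outlier p < outlier r"
proof -
  have pr: "p * r > 1" using assms by (smt (verit) mult_le_cancel_left1 mult_strict_left_mono)
  have "outlier r - outlier p = (r - p) * (1 - 1 / (p * r))"
    using assms by (simp add: outlier_def field_simps)
  moreover have "(r - p) * (1 - 1 / (p * r)) > 0" using assms pr by (intro mult_pos_pos) auto
  ultimately show ?thesis by simp
qed

lemma real_distribution_semicircle:
  assumes "semicircle_quantiles 1 q"
  shows "real_distribution semicircle"
proof -
  have "measure semicircle {- 2..2} = 1"
    using assms by (auto simp: semicircle_quantiles_def numeral_2_eq_2)
  then have 1: "emeasure semicircle {- 2..2} = 1"
    by (simp add: measure_def enn2real_eq_posreal_iff[of 1, simplified])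
  have "emeasure semicircle UNIV = emeasure semicircle {- 2..2}"
    unfolding semicircle_def
    by (subst (1 2) emeasure_density) (auto intro!: nn_integral_cong simp: indicator_def)
  then have "prob_space semicircle"
    by (intro prob_spaceI) (simp add: 1, simp add: semicircle_def)
  then show ?thesis
    unfolding real_distribution_def real_distribution_axioms_def by (simp add: semicircle_def)
qed

lemma rigid_last_eigval_ge:
  assumes quantiles: "\<And>K. K \<ge> 1 \<Longrightarrow> semicircle_quantiles K (q K)" and rigid: "rigid q lam"
  shows "\<forall>\<^sub>F n in sequentially. lam n n \<ge> - 3"
proof -
  obtain K where K: "K \<ge> 1" and ev: "\<forall>\<^sub>F n in sequentially.
        \<forall>i\<in>{1..K}. \<forall>j::nat.
          (real i - 1) * (real n - 2) / real K + 3 \<le> real j \<and>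
          real j \<le> real i * (real n - 2) / real K + 2 \<longrightarrow>
          \<bar>lam n j - q K i\<bar> \<le> 1"
    using rigid[unfolded rigid_def, rule_format, of 1] by auto
  have "q K (K + 1) \<le> q K K" "q K (K + 1) = - 2"
    using quantiles[OF K] K unfolding semicircle_quantiles_def
    by (metis atLeastAtMost_iff order_refl, metis)
  then have qK: "q K K \<ge> - 2" by simp
  show ?thesis
    \<comment> \<open>For \<open>n \<ge> K + 2\<close> the last block \<open>i = K\<close> contains the index \<open>j = n\<close>.\<close>
    using ev eventually_ge_at_top[of "K + 2"]
  proof eventually_elim
    case (elim n)
    have "(real K - 1) * (real n - 2) / real K + 3 = real n + 1 - (real n - 2) / real K"
      using K by (simp add: field_simps)
    moreover have "(real n - 2) / real K \<ge> 1" using elim(2) K by (simp add: field_simps)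
    ultimately have "(real K - 1) * (real n - 2) / real K + 3 \<le> real n" by simp
    moreover have "real n \<le> real K * (real n - 2) / real K + 2" using K by simp
    ultimately have "\<bar>lam n n - q K K\<bar> \<le> 1" using elim(1) K by auto
    then show ?case using qK by linarith
  qed
qed

text \<open>
  Weak convergence applies to the logarithm clamped to \<open>[- 3, outlier J]\<close>, an interval that contains
  all eigenvalues for large \<open>n\<close> as well as the support of the semicircle law. The sequence starts at
  dimension \<open>2\<close>, since the empirical measure of the eigenvalues from the second on is a probability
  measure only then.
\<close>
lemma log_det_limit:
  fixes A :: "nat \<Rightarrow> real mat"
  assumes sym: "\<And>n. real_symmetric n (A n)" and J: "J > 1"
    and top: "\<And>n. n \<ge> 2 \<Longrightarrow> eigval (A n) 1 = outlier J"
    and low: "\<forall>\<^sub>F n in sequentially. eigval (A n) n \<ge> - 3"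
    and conv: "weak_conv_m (\<lambda>n. empirical_measure_from_2 n (A n)) semicircle"
    and sc: "real_distribution semicircle" and p: "p > J"
  shows "(\<lambda>n. ln (det (shifted n (outlier p) (A n))) / n) \<longlonglongrightarrow> log_potential p"
proof -
  let ?l = "outlier J" and ?g = "outlier p"
  define f where "f x = ln (?g - max (- 3) (min ?l x))" for x
  have J2: "?l > 2" using outlier_strict_mono[of 1 J] J by (simp add: outlier_def)
  have gl: "?g > ?l" using outlier_strict_mono J p by simp
  have clamp: "max (- 3) (min ?l x) \<le> ?l" "max (- 3) (min ?l x) \<ge> - 3" for x using J2 by auto
  have cont: "isCont f x" for x
  proof -
    have "?g - max (- 3) (min ?l x) \<noteq> 0" using clamp(1)[of x] gl by linarith
    then show ?thesis unfolding f_def by (intro continuous_intros)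
  qed
  have bdd: "norm (f x) \<le> \<bar>ln (?g - ?l)\<bar> + \<bar>ln (?g + 3)\<bar>" for x
  proof -
    have "ln (?g - ?l) \<le> f x" "f x \<le> ln (?g + 3)"
      unfolding f_def using clamp[of x] gl by (auto simp: J2)
    then show ?thesis by (simp add: abs_le_iff) linarith
  qed
  define \<mu> where "\<mu> n = empirical_measure_from_2 (n + 2) (A (n + 2))" for n
  have rd: "real_distribution (\<mu> n)" for n
  proof -
    interpret prob_space "uniform_count_measure {2..n + 2}"
      by (rule prob_space_uniform_count_measure) auto
    show ?thesis unfolding \<mu>_def empirical_measure_from_2_def
      by (rule real_distribution_distr) (simp add: uniform_count_measure_def)
  qed
  have "weak_conv_m \<mu> semicircle"
    unfolding weak_conv_m_def weak_conv_def
  proof (intro allI impI)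
    fix x assume "isCont (cdf semicircle) x"
    then have "(\<lambda>n. cdf (empirical_measure_from_2 n (A n)) x) \<longlonglongrightarrow> cdf semicircle x"
      using conv unfolding weak_conv_m_def weak_conv_def by blast
    then show "(\<lambda>n. cdf (\<mu> n) x) \<longlonglongrightarrow> cdf semicircle x"
      unfolding \<mu>_def by (rule LIMSEQ_ignore_initial_segment)
  qed
  then have lim: "(\<lambda>n. integral\<^sup>L (\<mu> n) f) \<longlonglongrightarrow> integral\<^sup>L semicircle f"
    by (rule weak_conv_imp_integral_bdd_continuous_conv[OF rd sc _ cont bdd])
  have f_borel [measurable]: "f \<in> borel_measurable borel"
    using cont by (intro borel_measurable_continuous_onI) (simp add: continuous_at_imp_continuous_on)
  have "integral\<^sup>L semicircle f = (LINT x|semicircle. ln (?g - x))"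
  proof -
    have "max (- 3) (min ?l x) = x" if "x \<in> {- 2..2}" for x using that J2 by auto
    then have *: "indicator {- 2..2} x * (sqrt (4 - x\<^sup>2) / (2 * pi)) * f x =
        indicator {- 2..2} x * (sqrt (4 - x\<^sup>2) / (2 * pi)) * ln (?g - x)" for x
      by (auto simp: indicator_def f_def)
    have nn: "AE x::real in lborel. 0 \<le> indicator {- 2..2} x * (sqrt (4 - x\<^sup>2) / (2 * pi))"
      by (auto intro!: AE_I2 divide_nonneg_pos simp: indicator_def power2_le_iff_abs_le[of 2, simplified])
    have dens: "integral\<^sup>L semicircle h =
        (LBINT x. indicator {- 2..2} x * (sqrt (4 - x\<^sup>2) / (2 * pi)) * h x)"
      if [measurable]: "h \<in> borel_measurable borel" for h :: "real \<Rightarrow> real"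
      unfolding semicircle_def by (subst integral_density) (use nn in auto)
    have "integral\<^sup>L semicircle f = (LBINT x. indicator {- 2..2} x * (sqrt (4 - x\<^sup>2) / (2 * pi)) * f x)"
      by (rule dens) measurable
    also have "\<dots> = (LBINT x. indicator {- 2..2} x * (sqrt (4 - x\<^sup>2) / (2 * pi)) * ln (?g - x))"
      by (simp only: *)
    also have "\<dots> = (LINT x|semicircle. ln (?g - x))"
      by (rule dens[symmetric]) measurable
    finally show ?thesis .
  qed
  also have "\<dots> = log_potential p"
    using semicircle_log_integral[of p] J p by (simp add: outlier_def log_potential_def)
  finally have lim': "(\<lambda>n. integral\<^sup>L (\<mu> n) f) \<longlonglongrightarrow> log_potential p" using lim by simp
  have "(\<lambda>n. ln (?g - ?l) / real (n + 2) + (real (n + 2) - 1) / real (n + 2) * integral\<^sup>L (\<mu> n) f)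
      \<longlonglongrightarrow> 0 + 1 * log_potential p"
    by (intro tendsto_add tendsto_mult lim') real_asymp+
  moreover have "\<forall>\<^sub>F n in sequentially. ln (?g - ?l) / real (n + 2) +
      (real (n + 2) - 1) / real (n + 2) * integral\<^sup>L (\<mu> n) f =
      ln (det (shifted (n + 2) ?g (A (n + 2)))) / real (n + 2)"
    using eventually_compose_filterlim[OF low filterlim_add_const_nat_at_top[of 2]]
  proof eventually_elim
    case (elim n)
    let ?m = "n + 2"
    have range: "- 3 \<le> eigval (A ?m) j \<and> eigval (A ?m) j \<le> ?l" if "j \<in> {1..?m}" for j
      using eigval_antimono[OF sym[of ?m], of 1 j] eigval_antimono[OF sym[of ?m], of j ?m]
        that elim top[of ?m] by auto
    have "integral\<^sup>L (\<mu> n) f = (LINT j|uniform_count_measure {2..?m}. f (eigval (A ?m) j))"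
      unfolding \<mu>_def empirical_measure_from_2_def
      by (rule integral_distr) (auto simp: uniform_count_measure_def)
    also have "\<dots> = (\<Sum>j=2..?m. f (eigval (A ?m) j)) / real (card {2..?m})"
      by (rule integral_uniform_count_measure) auto
    also have "(\<Sum>j=2..?m. f (eigval (A ?m) j)) = (\<Sum>j=2..?m. ln (?g - eigval (A ?m) j))"
    proof (intro sum.cong refl)
      fix j assume "j \<in> {2..?m}"
      then have "max (- 3) (min ?l (eigval (A ?m) j)) = eigval (A ?m) j"
        using range[of j] by (simp add: max_absorb2 min_absorb2)
      then show "f (eigval (A ?m) j) = ln (?g - eigval (A ?m) j)" by (simp add: f_def)
    qed
    finally have int: "(\<Sum>j=2..?m. ln (?g - eigval (A ?m) j)) = (real ?m - 1) * integral\<^sup>L (\<mu> n) f"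
      by simp
    have pos: "?g - eigval (A ?m) j > 0" if "j \<in> {1..?m}" for j using range[OF that] gl by linarith
    have "ln (det (shifted ?m ?g (A ?m))) = (\<Sum>j=1..?m. ln (?g - eigval (A ?m) j))"
      unfolding det_shifted_eigval[OF sym] 
    proof (rule ln_prod)
      fix j assume "j \<in> {1..?m}"
      from pos[OF this] show "?g - eigval (A ?m) j \<noteq> 0" by simp
    qed simp
    also have "\<dots> = ln (?g - eigval (A ?m) 1) + (\<Sum>j=2..?m. ln (?g - eigval (A ?m) j))"
      by (subst sum.atLeast_Suc_atMost) (auto simp: numeral_2_eq_2)
    finally have D: "ln (det (shifted ?m ?g (A ?m))) =
        ln (?g - eigval (A ?m) 1) + (real ?m - 1) * integral\<^sup>L (\<mu> n) f" unfolding int .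
    have "eigval (A ?m) 1 = ?l" by (rule top) simp
    then show ?case unfolding D by (simp only: add_divide_distrib times_divide_eq_left)
  qed
  ultimately have "(\<lambda>n. ln (det (shifted (n + 2) ?g (A (n + 2)))) / real (n + 2)) \<longlonglongrightarrow> log_potential p"
    by (simp add: tendsto_cong)
  then show ?thesis by (rule LIMSEQ_offset)
qed


lemma ln_gauss_mass:
  assumes "c > 0" "det B > 0"
  shows "ln (gauss_mass n c B) = real n * (ln pi - ln c) / 2 - ln (det B) / 2"
proof -
  have "ln (gauss_mass n c B) = ln ((pi / c) ^ n / det B) / 2"
    unfolding gauss_mass_def using assms by (intro ln_sqrt) auto
  also have "ln ((pi / c) ^ n / det B) = real n * (ln pi - ln c) - ln (det B)"
    using assms by (simp add: ln_divide_pos ln_realpow)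
  finally show ?thesis by (simp add: diff_divide_distrib)
qed

lemma gauss_mass_pos: "c > 0 \<Longrightarrow> det B > 0 \<Longrightarrow> gauss_mass n c B > 0"
  by (simp add: gauss_mass_def)

lemma partition_function_bounds:
  assumes A: "A \<in> carrier_mat n n" and n: "n \<ge> 1" and L: "L > 0"
    and le: "ennreal L \<le> cone_integral n A \<beta>" and ge: "cone_integral n A \<beta> \<le> ennreal U"
  shows "ln L - ln (unit_ball_vol n) \<le> free_energy n A \<beta>"
    and "free_energy n A \<beta> \<le> ln U - ln (unit_ball_vol n)"
proof -
  have V: "unit_ball_vol (real n) > 0" by simp
  have fin: "cone_integral n A \<beta> < \<top>" using ge by (simp add: le_less_trans)
  then obtain I where I: "cone_integral n A \<beta> = ennreal I" "I \<ge> 0" by (cases "cone_integral n A \<beta>") auto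
  have "ennreal L \<le> ennreal U" using le ge by (rule order.trans)
  then have U: "U > 0" using L by (simp add: ennreal_le_iff2)
  have LI: "L \<le> I" "I \<le> U" using le ge I L U by (auto simp: ennreal_le_iff2)
  have Z: "partition_function n A \<beta> = I / unit_ball_vol n"
    unfolding partition_function_eq[OF A n] I(1) using I V by (simp add: divide_ennreal)
  have F: "free_energy n A \<beta> = ln I - ln (unit_ball_vol n)"
    unfolding free_energy_def Z using LI L V by (simp add: ln_divide_pos)
  show "ln L - ln (unit_ball_vol n) \<le> free_energy n A \<beta>" "free_energy n A \<beta> \<le> ln U - ln (unit_ball_vol n)"
    unfolding F using LI L by auto
qed

lemma eventually_exp_le_quarter:
  fixes x :: "nat \<Rightarrow> real"
  assumes lim: "(\<lambda>n. l n / n) \<longlonglongrightarrow> e" and e: "e < 0"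
  shows "\<forall>\<^sub>F n in sequentially. exp (l n) \<le> 1 / 4"
proof -
  have 1: "\<forall>\<^sub>F n in sequentially. l n / n < e / 2"
    using order_tendstoD(2)[OF lim, of "e / 2"] e by simp
  have "filterlim (\<lambda>n. e / 2 * real n) at_bot sequentially"
    using e by (intro filterlim_tendsto_neg_mult_at_bot[OF tendsto_const] filterlim_real_sequentially) auto
  then have "\<forall>\<^sub>F n in sequentially. e / 2 * real n \<le> ln (1 / 4)"
    by (simp add: filterlim_at_bot)
  with 1 show ?thesis
    using eventually_gt_at_top[of 0]
  proof eventually_elim
    case (elim n)
    have "l n \<le> e / 2 * real n" using elim by (simp add: field_simps)
    then have "l n \<le> ln (1 / 4)" using elim by linarith
    then have "exp (l n) \<le> exp (ln (1 / 4))" by (simp only: exp_le_cancel_iff)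
    also have "exp (ln (1 / 4 :: real)) = 1 / 4" by (rule exp_ln) simp
    finally show ?case .
  qed
qed

text \<open>
  The exponential rate of the tail bound, relative to the full Gaussian mass, for the weight with
  parameter \<open>p\<close> tilted to the parameter \<open>r\<close>. Here \<open>b\<close> is the inverse temperature, \<open>\<tau>\<close> the squared
  length of the shift and \<open>\<kappa>\<close> the threshold for the squared norm. It vanishes at \<open>r = p\<close>.
\<close>
definition chernoff :: "real \<Rightarrow> real \<Rightarrow> real \<Rightarrow> real \<Rightarrow> real \<Rightarrow> real \<Rightarrow> real" where
  "chernoff J b \<tau> \<kappa> p r =
     b / 2 * ((outlier p - outlier r) * (\<tau> * (outlier p - outlier J) / (outlier r - outlier J) - \<kappa>))
     + (log_potential p - log_potential r) / 2"

text \<open>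
  The sign of the derivative compares \<open>\<kappa>\<close> with \<open>\<tau> + 1 / (b p)\<close>, which is the limit of the expected
  squared norm.
\<close>
lemma chernoff_deriv:
  assumes J: "J > 1" and p: "p > J"
  shows "(chernoff J b \<tau> \<kappa> p has_real_derivative (1 - 1 / p\<^sup>2) / 2 * (b * (\<kappa> - \<tau>) - 1 / p)) (at p)"
proof -
  have ne: "outlier p - outlier J \<noteq> 0" using outlier_strict_mono[of J p] J p by simp
  have de: "(outlier has_real_derivative 1 - 1 / p\<^sup>2) (at p)"
    unfolding outlier_def[abs_def] using J p
    by (auto intro!: derivative_eq_intros simp: power2_eq_square field_simps)
  have dl: "(log_potential has_real_derivative (1 - 1 / p\<^sup>2) / p) (at p)"
    unfolding log_potential_def[abs_def] using J p
    by (auto intro!: derivative_eq_intros simp: power2_eq_square field_simps)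
  have "(chernoff J b \<tau> \<kappa> p has_real_derivative
      b / 2 * ((0 - (1 - 1 / p\<^sup>2)) * (\<tau> * (outlier p - outlier J) / (outlier p - outlier J) - \<kappa>) +
        ((0 * (outlier p - outlier J) - \<tau> * (outlier p - outlier J) * ((1 - 1 / p\<^sup>2) - 0)) /
           ((outlier p - outlier J) * (outlier p - outlier J)) - 0) * (outlier p - outlier p))
      + (0 - (1 - 1 / p\<^sup>2) / p) / 2) (at p)"
    unfolding chernoff_def[abs_def]
    by (intro DERIV_add DERIV_cmult DERIV_mult DERIV_diff DERIV_const DERIV_divide DERIV_cdivide de dl ne)
  then show ?thesis
  proof (rule DERIV_cong)
    define F where "F = 1 - 1 / p\<^sup>2"
    have "\<tau> * (outlier p - outlier J) / (outlier p - outlier J) = \<tau>" using ne by simp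
    then show "b / 2 * ((0 - (1 - 1 / p\<^sup>2)) * (\<tau> * (outlier p - outlier J) / (outlier p - outlier J) - \<kappa>) +
        ((0 * (outlier p - outlier J) - \<tau> * (outlier p - outlier J) * ((1 - 1 / p\<^sup>2) - 0)) /
           ((outlier p - outlier J) * (outlier p - outlier J)) - 0) * (outlier p - outlier p))
      + (0 - (1 - 1 / p\<^sup>2) / p) / 2 = (1 - 1 / p\<^sup>2) / 2 * (b * (\<kappa> - \<tau>) - 1 / p)"
      unfolding F_def[symmetric] using J p by (simp add: field_simps)
  qed
qed

section \<open>The free energy\<close>

text \<open>
  A realisation of the matrices: the top eigenvalue sits at \<open>outlier J\<close>, and the logarithms of the
  determinants of \<open>\<gamma> I - A n\<close> have the semicircular limit for every \<open>\<gamma>\<close> above the top eigenvalue.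
\<close>
locale spiked_matrices =
  fixes A :: "nat \<Rightarrow> real mat" and J \<beta> :: real
  assumes sym: "\<And>n. real_symmetric n (A n)" and J: "J > 1"
    and \<beta>: "\<beta> > 0" and supercritical: "\<beta> * J > 1"
    and top: "\<And>n. n \<ge> 2 \<Longrightarrow> eigval (A n) 1 = outlier J"
    and log_det: "\<And>p. p > J \<Longrightarrow>
      (\<lambda>n. ln (det (shifted n (outlier p) (A n))) / n) \<longlonglongrightarrow> log_potential p"
begin

lemma carrier: "A n \<in> carrier_mat n n"
  using sym by (simp add: real_symmetric_def)

lemma outlier_gt_eigval_1: "p > J \<Longrightarrow> n \<ge> 2 \<Longrightarrow> outlier p > eigval (A n) 1"
  using outlier_strict_mono[of J p] J top[of n] by simp

lemma gauss_mass_limit: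
  assumes p: "p > J" and b: "b > 0"
  shows "(\<lambda>n. ln (gauss_mass n (real n * b / 2) (shifted n (outlier p) (A n))) / n
      - ln (unit_ball_vol (real n)) / n) \<longlonglongrightarrow> - ln b / 2 - 1 / 2 - log_potential p / 2"
proof -
  have "(\<lambda>n. (ln pi - ln (b / 2)) / 2 - ln (det (shifted n (outlier p) (A n))) / n / 2
      - (ln (unit_ball_vol (real n)) / n + ln n / 2))
    \<longlonglongrightarrow> (ln pi - ln (b / 2)) / 2 - log_potential p / 2 - (ln (2 * pi) + 1) / 2"
    by (intro tendsto_diff tendsto_const tendsto_divide log_det[OF p] ln_unit_ball_vol_asymp) auto
  moreover have "\<forall>\<^sub>F n in sequentially. (ln pi - ln (b / 2)) / 2 - ln (det (shifted n (outlier p) (A n))) / n / 2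
      - (ln (unit_ball_vol (real n)) / n + ln n / 2) =
      ln (gauss_mass n (real n * b / 2) (shifted n (outlier p) (A n))) / n - ln (unit_ball_vol (real n)) / n"
    using eventually_ge_at_top[of 2]
  proof eventually_elim
    case (elim n)
    have "ln (real n * b / 2) = ln n + ln (b / 2)"
      using elim b ln_mult_pos[of "real n" "b / 2"] by simp
    moreover have "ln (gauss_mass n (real n * b / 2) (shifted n (outlier p) (A n))) =
        real n * (ln pi - ln (real n * b / 2)) / 2 - ln (det (shifted n (outlier p) (A n))) / 2"
      using elim b shifted_det_pos[OF sym outlier_gt_eigval_1[OF p elim]] by (intro ln_gauss_mass) auto
    ultimately have "ln (gauss_mass n (real n * b / 2) (shifted n (outlier p) (A n))) / n =
        (ln pi - (ln n + ln (b / 2))) / 2 - ln (det (shifted n (outlier p) (A n))) / n / 2"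
      using elim by (simp add: diff_divide_distrib)
    then show ?case by (simp add: add_divide_distrib diff_divide_distrib)
  qed
  moreover have "(ln pi - ln (b / 2)) / 2 - log_potential p / 2 - (ln (2 * pi) + 1) / 2
      = - ln b / 2 - 1 / 2 - log_potential p / 2"
    using b by (simp add: ln_mult_pos ln_divide_pos add_divide_distrib diff_divide_distrib)
  ultimately show ?thesis by (simp only: tendsto_cong)
qed

lemma cone_upper:
  assumes p: "p > J" and n: "n \<ge> 2"
  shows "cone_integral n (A n) \<beta> \<le> ennreal (exp (real n * \<beta> / 2 * outlier p) *
    gauss_mass n (real n * \<beta> / 2) (shifted n (outlier p) (A n)))"
  using cone_integral_upper[OF sym outlier_gt_eigval_1[OF p n] \<beta>] n by simp

lemma chernoff_negative:
  assumes p: "p > J" and \<kappa>: "b * (\<kappa> - \<tau>) \<noteq> 1 / p"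
  obtains r where "r > J" and "chernoff J b \<tau> \<kappa> p r < 0"
    and "if b * (\<kappa> - \<tau>) > 1 / p then r < p else r > p"
proof -
  have zero: "chernoff J b \<tau> \<kappa> p p = 0" by (simp add: chernoff_def)
  have "p * p > 1 * 1" using J p by (intro mult_strict_mono) auto
  then have fac: "(1 - 1 / p\<^sup>2) / 2 > 0" by (simp add: power2_eq_square)
  note deriv = chernoff_deriv[OF J p, where b = b and \<kappa> = \<kappa> and \<tau> = \<tau>]
  let ?D = "(1 - 1 / p\<^sup>2) / 2 * (b * (\<kappa> - \<tau>) - 1 / p)"
  show ?thesis
  proof (cases "b * (\<kappa> - \<tau>) > 1 / p")
    case True
    then have "?D > 0" using fac by (intro mult_pos_pos) auto
    then obtain d where d: "d > 0" "\<And>h. 0 < h \<Longrightarrow> h < d \<Longrightarrow> chernoff J b \<tau> \<kappa> p (p - h) < 0"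
      using DERIV_pos_inc_left[OF deriv] unfolding zero by metis
    define h where "h = min d (p - J) / 2"
    have h: "0 < h" "h < d" "p - h > J" using d(1) p by (auto simp: h_def min_def field_simps)
    show ?thesis using that[of "p - h"] h d(2)[OF h(1,2)] True by auto
  next
    case False
    then have "b * (\<kappa> - \<tau>) - 1 / p < 0" using \<kappa> by simp
    then have "?D < 0" by (rule mult_pos_neg[OF fac])
    then obtain d where d: "d > 0" "\<And>h. 0 < h \<Longrightarrow> h < d \<Longrightarrow> chernoff J b \<tau> \<kappa> p (p + h) < 0"
      using DERIV_neg_dec_right[OF deriv] unfolding zero by metis
    have h: "0 < d / 2" "d / 2 < d" using d(1) by auto
    show ?thesis using that[of "p + d / 2"] h p d(2)[OF h] False by auto
  qed
qed

lemma tail_negligible: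
  assumes p: "p > J" and r: "r > J" and b: "b > 0" and neg: "chernoff J b \<tau> \<kappa> p r < 0"
  shows "\<forall>\<^sub>F n in sequentially.
    exp (real n * b / 2 * (outlier p - outlier r) *
        (\<tau> * (outlier p - eigval (A n) 1) / (outlier r - eigval (A n) 1) - \<kappa>)) *
      gauss_mass n (real n * b / 2) (shifted n (outlier r) (A n))
    \<le> gauss_mass n (real n * b / 2) (shifted n (outlier p) (A n)) / 4"
proof -
  let ?G = "\<lambda>q n. gauss_mass n (real n * b / 2) (shifted n (outlier q) (A n))"
  let ?x = "(outlier p - outlier r) * (\<tau> * (outlier p - outlier J) / (outlier r - outlier J) - \<kappa>)"
  define l where "l n = real n * b / 2 * ?x + ln (?G r n) - ln (?G p n)" for n
  have "(\<lambda>n. b / 2 * ?x + (ln (?G r n) / n - ln (unit_ball_vol (real n)) / n)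
      - (ln (?G p n) / n - ln (unit_ball_vol (real n)) / n)) \<longlonglongrightarrow>
     b / 2 * ?x + (- ln b / 2 - 1 / 2 - log_potential r / 2) - (- ln b / 2 - 1 / 2 - log_potential p / 2)"
    by (intro tendsto_add tendsto_diff tendsto_const gauss_mass_limit p r b)
  moreover have "b / 2 * ?x + (- ln b / 2 - 1 / 2 - log_potential r / 2)
      - (- ln b / 2 - 1 / 2 - log_potential p / 2) = chernoff J b \<tau> \<kappa> p r"
    by (simp add: chernoff_def diff_divide_distrib)
  moreover have "\<forall>\<^sub>F n in sequentially. b / 2 * ?x + (ln (?G r n) / n - ln (unit_ball_vol (real n)) / n)
      - (ln (?G p n) / n - ln (unit_ball_vol (real n)) / n) = l n / n"
    using eventually_gt_at_top[of 0]
    by eventually_elim (simp add: l_def add_divide_distrib diff_divide_distrib)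
  ultimately have "(\<lambda>n. l n / n) \<longlonglongrightarrow> chernoff J b \<tau> \<kappa> p r" by (simp only: tendsto_cong)
  then have "\<forall>\<^sub>F n in sequentially. exp (l n) \<le> 1 / 4" by (rule eventually_exp_le_quarter[OF _ neg])
  then show ?thesis
    using eventually_ge_at_top[of 2]
  proof eventually_elim
    case (elim n)
    have G: "?G q n > 0" if "q > J" for q
      using elim b shifted_det_pos[OF sym outlier_gt_eigval_1[OF that elim(2)]] by (intro gauss_mass_pos) auto
    have "exp (real n * b / 2 * ?x) * ?G r n = exp (l n) * ?G p n"
      unfolding l_def using G[OF p] G[OF r] by (simp add: exp_add exp_diff)
    also have "\<dots> \<le> 1 / 4 * ?G p n" using elim(1) G[OF p] by (intro mult_right_mono) auto
    finally show ?case using top[OF elim(2)] by (simp add: mult.assoc)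
  qed
qed

lemma cone_lower:
  assumes p: "p > J" and \<delta>: "0 < \<delta>" "\<delta> < 1"
  shows "\<forall>\<^sub>F n in sequentially. ennreal (exp (real n * \<beta> / 2 * outlier J) *
      (gauss_mass n (real n * (\<beta> / (1 - \<delta>)) / 2) (shifted n (outlier p) (A n)) / 2)) \<le> cone_integral n (A n) \<beta>"
proof -
  define b where "b = \<beta> / (1 - \<delta>)"
  \<comment> \<open>With this squared shift the squared norm concentrates at \<open>\<tau> + 1 / (b p) = 1 - \<delta> / 2\<close>, the middle
    of the shell; that \<open>\<tau>\<close> is nonnegative is where \<open>\<beta> J > 1\<close> enters.\<close>
  define \<tau> where "\<tau> = 1 - 1 / (b * p) - \<delta> / 2"
  have b: "b > 0" using \<beta> \<delta> by (simp add: b_def)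
  have bp: "b * p > 0" using b p J by simp
  have "\<beta> * p > 1" using supercritical p \<beta> by (smt (verit) mult_strict_left_mono)
  then have "(1 - \<delta>) / (\<beta> * p) \<le> (1 - \<delta>) / 1" using \<delta> by (intro divide_left_mono) auto
  then have "1 / (b * p) \<le> 1 - \<delta>" by (simp add: b_def)
  then have \<tau>: "\<tau> \<ge> 0" using \<delta> by (simp add: \<tau>_def)
  have bt: "b * \<tau> = b - 1 / p - b * \<delta> / 2" using b p J by (simp add: \<tau>_def algebra_simps)
  have bd: "b * \<delta> > 0" using b \<delta> by simp
  have k1: "b * (1 - \<tau>) > 1 / p" using bt bd by (simp add: algebra_simps)
  obtain r1 where r1: "r1 > J" "chernoff J b \<tau> 1 p r1 < 0" "r1 < p"
    using chernoff_negative[OF p, of b 1 \<tau>] k1 by (metis less_irrefl)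
  have k2: "b * ((1 - \<delta>) - \<tau>) < 1 / p" using bt bd by (simp add: algebra_simps)
  obtain r2 where r2: "r2 > J" "chernoff J b \<tau> (1 - \<delta>) p r2 < 0" "r2 > p"
    using chernoff_negative[OF p, of b "1 - \<delta>" \<tau>] k2 by (metis less_irrefl less_asym)
  have s: "(sqrt \<tau>)\<^sup>2 = \<tau>" using \<tau> by simp
  show ?thesis
    using tail_negligible[OF p r1(1) b r1(2)] tail_negligible[OF p r2(1) b r2(2)] eventually_ge_at_top[of 2]
  proof eventually_elim
    case (elim n)
    let ?c = "real n * b / 2"
    let ?E = "\<lambda>\<rho> \<kappa>. exp (?c * (outlier p - \<rho>) * (\<tau> * (outlier p - eigval (A n) 1) / (\<rho> - eigval (A n) 1) - \<kappa>)) *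
      gauss_mass n ?c (shifted n \<rho> (A n))"
    have c: "real n * \<beta> / 2 / (1 - \<delta>) = ?c" by (simp add: b_def)
    have ed: "outlier r1 < outlier p" "outlier p < outlier r2" using outlier_strict_mono J r1 r2 p by simp_all
    have "ennreal (exp (real n * \<beta> / 2 * eigval (A n) 1) *
        (gauss_mass n ?c (shifted n (outlier p) (A n)) - (?E (outlier r1) 1 + ?E (outlier r2) (1 - \<delta>))))
      \<le> cone_integral n (A n) \<beta>"
      using cone_integral_lower[OF sym \<beta> _ \<delta> outlier_gt_eigval_1[OF r1(1) elim(3)] ed, of "sqrt \<tau>"] elim(3)
      unfolding s c by simp
    moreover have "gauss_mass n ?c (shifted n (outlier p) (A n)) / 2 \<le>
        gauss_mass n ?c (shifted n (outlier p) (A n)) - (?E (outlier r1) 1 + ?E (outlier r2) (1 - \<delta>))"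
      using elim(1,2) by linarith
    then have "ennreal (exp (real n * \<beta> / 2 * outlier J) * (gauss_mass n ?c (shifted n (outlier p) (A n)) / 2)) \<le>
       ennreal (exp (real n * \<beta> / 2 * eigval (A n) 1) *
        (gauss_mass n ?c (shifted n (outlier p) (A n)) - (?E (outlier r1) 1 + ?E (outlier r2) (1 - \<delta>))))"
      unfolding top[OF elim(3)] by (intro ennreal_leI mult_left_mono) auto
    ultimately show ?case unfolding b_def[symmetric] by (rule order.trans[rotated])
  qed
qed

lemma free_energy_upper:
  assumes p: "p > J" and e: "e > \<beta> / 2 * outlier p - ln \<beta> / 2 - 1 / 2 - log_potential p / 2"
  shows "\<forall>\<^sub>F n in sequentially. free_energy n (A n) \<beta> / n < e"
proof -
  let ?G = "\<lambda>n. gauss_mass n (real n * \<beta> / 2) (shifted n (outlier p) (A n))"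
  have "(\<lambda>n. \<beta> / 2 * outlier p + (ln (?G n) / n - ln (unit_ball_vol (real n)) / n)) \<longlonglongrightarrow>
      \<beta> / 2 * outlier p + (- ln \<beta> / 2 - 1 / 2 - log_potential p / 2)"
    by (intro tendsto_add tendsto_const gauss_mass_limit p \<beta>)
  then have "\<forall>\<^sub>F n in sequentially. \<beta> / 2 * outlier p + (ln (?G n) / n - ln (unit_ball_vol (real n)) / n) < e"
    by (rule order_tendstoD) (use e in simp)
  then show ?thesis
    \<comment> \<open>Some positive lower bound is needed to take logarithms; the choice \<open>\<delta> = 1 / 2\<close> is arbitrary.\<close>
    using cone_lower[OF p, of "1 / 2", simplified] eventually_ge_at_top[of 2]
  proof eventually_elim
    case (elim n)
    have G: "gauss_mass n (real n * x / 2) (shifted n (outlier p) (A n)) > 0" if "x > 0" for x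
      using elim that shifted_det_pos[OF sym outlier_gt_eigval_1[OF p elim(3)]] by (intro gauss_mass_pos) auto
    have "free_energy n (A n) \<beta> \<le> ln (exp (real n * \<beta> / 2 * outlier p) * ?G n) - ln (unit_ball_vol n)"
      by (rule partition_function_bounds(2)[OF carrier _ _ elim(2) cone_upper[OF p elim(3)]])
         (use elim(3) G[of "2 * \<beta>"] \<beta> in \<open>simp_all add: mult_ac\<close>)
    also have "ln (exp (real n * \<beta> / 2 * outlier p) * ?G n) = real n * \<beta> / 2 * outlier p + ln (?G n)"
      using G[OF \<beta>] by (simp add: ln_mult_pos)
    finally have "free_energy n (A n) \<beta> / n \<le>
        (real n * \<beta> / 2 * outlier p + ln (?G n) - ln (unit_ball_vol n)) / n"
      by (intro divide_right_mono) auto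
    also have "\<dots> = \<beta> / 2 * outlier p + (ln (?G n) / n - ln (unit_ball_vol (real n)) / n)"
      using elim(3) by (simp add: add_divide_distrib diff_divide_distrib)
    finally show ?case using elim(1) by linarith
  qed
qed

lemma free_energy_lower:
  assumes p: "p > J" and \<delta>: "0 < \<delta>" "\<delta> < 1"
    and e: "e < \<beta> / 2 * outlier J - ln (\<beta> / (1 - \<delta>)) / 2 - 1 / 2 - log_potential p / 2"
  shows "\<forall>\<^sub>F n in sequentially. free_energy n (A n) \<beta> / n > e"
proof -
  define b where "b = \<beta> / (1 - \<delta>)"
  have b: "b > 0" using \<beta> \<delta> by (simp add: b_def)
  let ?G = "\<lambda>n. gauss_mass n (real n * b / 2) (shifted n (outlier p) (A n))"
  have "(\<lambda>n. \<beta> / 2 * outlier J + (ln (?G n) / n - ln (unit_ball_vol (real n)) / n) - ln 2 / n) \<longlonglongrightarrow>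
      \<beta> / 2 * outlier J + (- ln b / 2 - 1 / 2 - log_potential p / 2) - 0"
    by (intro tendsto_add tendsto_diff tendsto_const gauss_mass_limit p b) real_asymp
  then have "\<forall>\<^sub>F n in sequentially.
      e < \<beta> / 2 * outlier J + (ln (?G n) / n - ln (unit_ball_vol (real n)) / n) - ln 2 / n"
    by (rule order_tendstoD) (use e in \<open>simp add: b_def\<close>)
  then show ?thesis
    using cone_lower[OF p \<delta>] eventually_ge_at_top[of 2]
  proof eventually_elim
    case (elim n)
    have G: "?G n > 0"
      using elim b shifted_det_pos[OF sym outlier_gt_eigval_1[OF p elim(3)]] by (intro gauss_mass_pos) auto
    have "ln (exp (real n * \<beta> / 2 * outlier J) * (?G n / 2)) - ln (unit_ball_vol n) \<le> free_energy n (A n) \<beta>"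
      by (rule partition_function_bounds(1)[OF carrier _ _ _ cone_upper[OF p elim(3)]])
         (use elim(2,3) G in \<open>simp_all add: b_def\<close>)
    moreover have "ln (exp (real n * \<beta> / 2 * outlier J) * (?G n / 2)) = real n * \<beta> / 2 * outlier J + ln (?G n) - ln 2"
      using G by (simp add: ln_mult_pos ln_divide_pos)
    ultimately have "(real n * \<beta> / 2 * outlier J + ln (?G n) - ln 2 - ln (unit_ball_vol n)) / n
        \<le> free_energy n (A n) \<beta> / n"
      by (intro divide_right_mono) auto
    moreover have "(real n * \<beta> / 2 * outlier J + ln (?G n) - ln 2 - ln (unit_ball_vol n)) / n =
        \<beta> / 2 * outlier J + (ln (?G n) / n - ln (unit_ball_vol (real n)) / n) - ln 2 / n"
      using elim(3) by (simp add: add_divide_distrib diff_divide_distrib)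
    ultimately show ?case using elim(1) by linarith
  qed
qed

theorem free_energy_limit:
  "(\<lambda>n. free_energy n (A n) \<beta> / n) \<longlonglongrightarrow>
     \<beta> / 2 * outlier J - ln \<beta> / 2 - 1 / 2 - log_potential J / 2"
proof (rule order_tendstoI)
  let ?T = "\<beta> / 2 * outlier J - ln \<beta> / 2 - 1 / 2 - log_potential J / 2"
  have J0: "J \<noteq> 0" "J > 0" using J by simp_all
  have lims: "((\<lambda>x. outlier (J + x)) \<longlongrightarrow> outlier (J + 0)) (at_right 0)"
     "((\<lambda>x. log_potential (J + x)) \<longlongrightarrow> log_potential (J + 0)) (at_right 0)"
    unfolding outlier_def log_potential_def using J0 by (auto intro!: tendsto_eq_intros)
  have id: "((\<lambda>x. x) \<longlongrightarrow> (0::real)) (at_right 0)" by (rule tendsto_ident_at)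
  {
    fix e assume e: "e > ?T"
    have "((\<lambda>x. \<beta> / 2 * outlier (J + x) - ln \<beta> / 2 - 1 / 2 - log_potential (J + x) / 2) \<longlongrightarrow> ?T) (at_right 0)"
      using lims by (auto intro!: tendsto_eq_intros)
    then have "\<forall>\<^sub>F x in at_right 0. \<beta> / 2 * outlier (J + x) - ln \<beta> / 2 - 1 / 2 - log_potential (J + x) / 2 < e \<and> x > 0"
      by (intro eventually_conj order_tendstoD(2)[OF _ e] eventually_at_right_less)
    then obtain x where "\<beta> / 2 * outlier (J + x) - ln \<beta> / 2 - 1 / 2 - log_potential (J + x) / 2 < e" "x > 0"
      using eventually_happens'[OF trivial_limit_at_right_real] by blast
    then show "\<forall>\<^sub>F n in sequentially. free_energy n (A n) \<beta> / n < e"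
      using free_energy_upper[of "J + x" e] by simp
  next
    fix e assume e: "e < ?T"
    \<comment> \<open>One parameter \<open>x\<close> serves for both \<open>p = J + x\<close> and \<open>\<delta> = x\<close>.\<close>
    have "((\<lambda>x. \<beta> / 2 * outlier J - ln (\<beta> / (1 - x)) / 2 - 1 / 2 - log_potential (J + x) / 2) \<longlongrightarrow>
        \<beta> / 2 * outlier J - ln (\<beta> / (1 - 0)) / 2 - 1 / 2 - log_potential (J + 0) / 2) (at_right 0)"
      using \<beta> by (intro tendsto_intros lims id) auto
    then have "((\<lambda>x. \<beta> / 2 * outlier J - ln (\<beta> / (1 - x)) / 2 - 1 / 2 - log_potential (J + x) / 2) \<longlongrightarrow> ?T) (at_right 0)"
      by simp
    then have "\<forall>\<^sub>F x in at_right 0. e < \<beta> / 2 * outlier J - ln (\<beta> / (1 - x)) / 2 - 1 / 2 - log_potential (J + x) / 2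
       \<and> x > 0 \<and> x < 1"
      by (intro eventually_conj order_tendstoD(1)[OF _ e] eventually_at_right_less order_tendstoD(2)[OF id]) auto
    then obtain x where "e < \<beta> / 2 * outlier J - ln (\<beta> / (1 - x)) / 2 - 1 / 2 - log_potential (J + x) / 2" "x > 0" "x < 1"
      using eventually_happens'[OF trivial_limit_at_right_real] by blast
    then show "\<forall>\<^sub>F n in sequentially. free_energy n (A n) \<beta> / n > e"
      using free_energy_lower[of "J + x" x e] by simp
  }
qed

end

theorem theorem1:
  fixes M :: "'w measure"
    and X :: "nat \<Rightarrow> 'w \<Rightarrow> real mat"
    and q :: "nat \<Rightarrow> nat \<Rightarrow> real"
    and J \<beta> c :: real
  assumes "J > 1" and "\<beta> > 0" and "\<beta> * J > 1" and "c \<ge> 0"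
    and "prob_space M"
    and symmetric: "\<And>n \<omega>. \<omega> \<in> space M \<Longrightarrow> real_symmetric n (X n \<omega>)"
    and measurable: "\<And>n i j. i < n \<Longrightarrow> j < n \<Longrightarrow> (\<lambda>\<omega>. X n \<omega> $$ (i, j)) \<in> borel_measurable M"
    and eigval_1: "\<And>n. n \<ge> 2 \<Longrightarrow> AE \<omega> in M. eigval (X n \<omega>) 1 = J + 1 / J"
    and eigval_2: "\<And>n. n \<ge> 2 \<Longrightarrow> AE \<omega> in M. eigval (X n \<omega>) 2 = eigval (X n \<omega>) 1 - c / real n"
    and empirical: "AE \<omega> in M. weak_conv_m (\<lambda>n. empirical_measure_from_2 n (X n \<omega>)) semicircle"
    and quantiles: "\<And>K. K \<ge> 1 \<Longrightarrow> semicircle_quantiles K (q K)"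
    and rigidity: "AE \<omega> in M. rigid q (\<lambda>n. eigval (X n \<omega>))"
  shows "AE \<omega> in M. (\<lambda>n. free_energy n (X n \<omega>) \<beta> / real n) \<longlonglongrightarrow>
           \<beta> / 2 * (J + 1 / J) * (1 - 1 / (\<beta> * J)) + 1 / 2 * ln (1 / (\<beta> * J)) + 1 / (4 * J\<^sup>2)"
proof -
  have "AE \<omega> in M. \<forall>n. n \<ge> 2 \<longrightarrow> eigval (X n \<omega>) 1 = J + 1 / J"
    unfolding AE_all_countable using eigval_1 by auto
  with empirical rigidity AE_space show ?thesis
  proof eventually_elim
    case (elim \<omega>)
    have sym: "real_symmetric n (X n \<omega>)" for n using symmetric elim by simp
    have top: "eigval (X n \<omega>) 1 = outlier J" if "n \<ge> 2" for n using elim that by (simp add: outlier_def)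
    have sc: "real_distribution semicircle" by (rule real_distribution_semicircle[OF quantiles]) simp
    interpret spiked_matrices "\<lambda>n. X n \<omega>" J \<beta>
      by unfold_locales
         (use assms(1-3) sym top log_det_limit[OF sym assms(1) top rigid_last_eigval_ge[OF quantiles elim(2)] elim(1) sc]
           in auto)
    have "\<beta> / 2 * outlier J - ln \<beta> / 2 - 1 / 2 - log_potential J / 2 =
       \<beta> / 2 * (J + 1 / J) * (1 - 1 / (\<beta> * J)) + 1 / 2 * ln (1 / (\<beta> * J)) + 1 / (4 * J\<^sup>2)"
    proof -
      have "ln (1 / (\<beta> * J)) = - ln \<beta> - ln J"
        using assms(1,2) by (simp add: ln_divide_pos ln_mult_pos)
      moreover have "\<beta> / 2 * (J + 1 / J) * (1 - 1 / (\<beta> * J)) = \<beta> / 2 * (J + 1 / J) - 1 / 2 - 1 / (2 * J\<^sup>2)"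
        using assms(1,2) by (simp add: field_simps power2_eq_square)
      ultimately show ?thesis by (simp add: outlier_def log_potential_def add_divide_distrib diff_divide_distrib)
    qed
    then show ?case using free_energy_limit by simp
  qed
qed

end
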